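(* Let $n\ge 2$, $R>0$, $\Lambda\ge\lambda>0$, $q\in(n,\infty]$, $\alpha\in(0,1-n/q)$. Let $A:B_R\to\mathbb{R}^{n\times n}$ satisfy $\Lambda I\ge A(x)\ge\lambda I$ in $B_R$, and let $A,b_1\in C^\alpha(B_R)$, $b_2,c\in L^q(B_R)$. Let $\mathcal{L}u=\mathrm{div}(A\nabla u+b_1u)+b_2\cdot\nabla u+cu$. Then, with a constant $C_0>0$ depending only on $n,\lambda,\Lambda,q,\alpha$, $$\lambda_1(-\mathcal{L},B_R)\le C_0\,(M_1+R^{-1})^2.$$
   Context: $B_R=\{x\in\mathbb{R}^n:|x|<R\}$. Matrix inequalities are in the sense of quadratic forms ($A$ is not assumed symmetric). $[\cdot]_{\alpha,B_R}$ is the usual Hölder seminorm on $B_R$. $\lambda_1(-\mathcal{L},\Omega)$ denotes the first (principal) Dirichlet eigenvalue of $-\mathcal{L}$ in the bounded domain $\Omega$: the real, simple eigenvalue with smallest real part, characterized by the existence of $\varphi_1\in H^1_0(\Omega)$, $\varphi_1>0$, with $-\mathcal{L}\varphi_1=\lambda_1\varphi_1$ weakly in $\Omega$. Set $\|h\|_{L^q_{ul}(B_R)}=\sup_{x_0\in B_R}\|h\|_{L^q(B_R\cap B_1(x_0))}$ for $q<\infty$, $\|h\|_{L^\infty_{ul}(B_R)}=\|h\|_{L^\infty(B_R)}$; $\sigma_q(x)=\max\{x,x^{\frac1{1-n/q}}\}$ for $q\in(n,\infty)$, $\sigma_\infty(x)=x$ (so $\sigma_{2q}(x)=\max\{x,x^{\frac1{1-n/(2q)}}\}$);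 and $$M_1=[A]_{\alpha,B_R}^{1/\alpha}+[b_1]_{\alpha,B_R}^{1/(\alpha+1)}+\|b_1\|_{L^\infty(B_R)}+\sigma_q\bigl(\|b_2\|_{L^q_{ul}(B_R)}\bigr)+\sigma_{2q}\bigl(\|c\|_{L^q_{ul}(B_R)}^{1/2}\bigr).$$ *)

theory Defs
  imports "HOL-Analysis.Analysis" "HOL-Probability.Essential_Supremum"
begin

section \<open>Lebesgue and Hoelder norms\<close>

text \<open>Lebesgue exponents are extended reals, so that \<open>q = \<infinity>\<close> is allowed. All norms are
  real-valued and meaningful only for functions in the corresponding space. On vectors and
  matrices \<^const>\<open>norm\<close> is the Euclidean (Frobenius) norm.\<close>

definition in_Lq :: "ereal \<Rightarrow> 'a::euclidean_space set \<Rightarrow> ('a \<Rightarrow> 'b::euclidean_space) \<Rightarrow> bool" where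
  "in_Lq q S h \<longleftrightarrow> h \<in> borel_measurable (lebesgue_on S) \<and>
     (if q = \<infinity> then \<exists>K. AE x in lebesgue_on S. norm (h x) \<le> K
      else integrable (lebesgue_on S) (\<lambda>x. norm (h x) powr real_of_ereal q))"

definition Lq_norm :: "ereal \<Rightarrow> 'a::euclidean_space set \<Rightarrow> ('a \<Rightarrow> 'b::euclidean_space) \<Rightarrow> real" where
  "Lq_norm q S h =
     (if q = \<infinity> then real_of_ereal (esssup (lebesgue_on S) (\<lambda>x. ereal (norm (h x))))
      else (LINT x|lebesgue_on S. norm (h x) powr real_of_ereal q) powr (1 / real_of_ereal q))"

definition Lq_ul_norm :: "ereal \<Rightarrow> real \<Rightarrow> ('a::euclidean_space \<Rightarrow> 'b::euclidean_space) \<Rightarrow> real" where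
  "Lq_ul_norm q R h =
     (if q = \<infinity> then Lq_norm \<infinity> (ball 0 R) h
      else (SUP x0\<in>ball 0 R. Lq_norm q (ball 0 R \<inter> ball x0 1) h))"

text \<open>On a bounded set the finiteness of the Hoelder seminorm already implies boundedness.\<close>

definition holder_on :: "real \<Rightarrow> 'a::metric_space set \<Rightarrow> ('a \<Rightarrow> 'b::real_normed_vector) \<Rightarrow> bool" where
  "holder_on \<alpha> S f \<longleftrightarrow> (\<exists>K. \<forall>x\<in>S. \<forall>y\<in>S. norm (f x - f y) \<le> K * dist x y powr \<alpha>)"

definition holder_seminorm :: "real \<Rightarrow> 'a::metric_space set \<Rightarrow> ('a \<Rightarrow> 'b::real_normed_vector) \<Rightarrow> real" where
  "holder_seminorm \<alpha> S f =
     (SUP (x, y)\<in>{(x, y). x \<in> S \<and> y \<in> S \<and> x \<noteq> y}. norm (f x - f y) / dist x y powr \<alpha>)"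

section \<open>The Sobolev space of functions with zero trace\<close>

definition gradient :: "(real^'n \<Rightarrow> real) \<Rightarrow> real^'n \<Rightarrow> real^'n" where
  "gradient f x = (\<chi> i. frechet_derivative f (at x) (axis i 1))"

primrec Ck :: "nat \<Rightarrow> (real^'n \<Rightarrow> real) \<Rightarrow> bool" where
  "Ck 0 f \<longleftrightarrow> continuous_on UNIV f"
| "Ck (Suc k) f \<longleftrightarrow> f differentiable_on UNIV \<and> (\<forall>i. Ck k (\<lambda>x. gradient f x $ i))"

definition test_function :: "(real^'n) set \<Rightarrow> (real^'n \<Rightarrow> real) \<Rightarrow> bool" where
  "test_function \<Omega> \<phi> \<longleftrightarrow> (\<forall>k. Ck k \<phi>) \<and>
     compact (closure {x. \<phi> x \<noteq> 0}) \<and> closure {x. \<phi> x \<noteq> 0} \<subseteq> \<Omega>"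

definition weak_gradient :: "(real^'n) set \<Rightarrow> (real^'n \<Rightarrow> real) \<Rightarrow> (real^'n \<Rightarrow> real^'n) \<Rightarrow> bool" where
  "weak_gradient \<Omega> u Du \<longleftrightarrow> (\<forall>\<phi> i. test_function \<Omega> \<phi> \<longrightarrow>
     (LINT x|lebesgue_on \<Omega>. u x * gradient \<phi> x $ i) = - (LINT x|lebesgue_on \<Omega>. Du x $ i * \<phi> x))"

text \<open>\<open>H10 \<Omega> u Du\<close> says that \<open>u\<close> belongs to \<open>H\<^sup>1\<^sub>0(\<Omega>)\<close>, the closure of the test functions in
  \<open>H\<^sup>1(\<Omega>)\<close>, and that \<open>Du\<close> is (a representative of) its weak gradient.\<close>

definition H10 :: "(real^'n) set \<Rightarrow> (real^'n \<Rightarrow> real) \<Rightarrow> (real^'n \<Rightarrow> real^'n) \<Rightarrow> bool" where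
  "H10 \<Omega> u Du \<longleftrightarrow> in_Lq 2 \<Omega> u \<and> in_Lq 2 \<Omega> Du \<and> weak_gradient \<Omega> u Du \<and>
     (\<exists>\<phi>. (\<forall>k. test_function \<Omega> (\<phi> k)) \<and>
        (\<lambda>k::nat. Lq_norm 2 \<Omega> (\<lambda>x. \<phi> k x - u x)) \<longlonglongrightarrow> 0 \<and>
        (\<lambda>k. Lq_norm 2 \<Omega> (\<lambda>x. gradient (\<phi> k) x - Du x)) \<longlonglongrightarrow> 0)"

section \<open>The principal Dirichlet eigenvalue\<close>

text \<open>The bilinear form of \<open>-\<L>\<close>, where
  \<open>\<L>u = div (A \<nabla>u + b\<^sub>1 u) + b\<^sub>2 \<bullet> \<nabla>u + c u\<close>.\<close>

definition neg_L_form ::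
  "(real^'n) set \<Rightarrow> (real^'n \<Rightarrow> real^'n^'n) \<Rightarrow> (real^'n \<Rightarrow> real^'n) \<Rightarrow> (real^'n \<Rightarrow> real^'n) \<Rightarrow>
   (real^'n \<Rightarrow> real) \<Rightarrow> (real^'n \<Rightarrow> real) \<Rightarrow> (real^'n \<Rightarrow> real^'n) \<Rightarrow> (real^'n \<Rightarrow> real) \<Rightarrow> real" where
  "neg_L_form \<Omega> A b1 b2 c u Du \<phi> =
     (LINT x|lebesgue_on \<Omega>. (A x *v Du x + u x *\<^sub>R b1 x) \<bullet> gradient \<phi> x
        - (b2 x \<bullet> Du x) * \<phi> x - c x * u x * \<phi> x)"

text \<open>\<open>-\<L>w = f\<close> weakly in \<open>\<Omega>\<close> with \<open>w \<in> H\<^sup>1\<^sub>0(\<Omega>; \<complex>)\<close>. The coefficients are real, so the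
  equation splits into its real and imaginary parts.\<close>

definition weak_solution ::
  "(real^'n) set \<Rightarrow> (real^'n \<Rightarrow> real^'n^'n) \<Rightarrow> (real^'n \<Rightarrow> real^'n) \<Rightarrow> (real^'n \<Rightarrow> real^'n) \<Rightarrow>
   (real^'n \<Rightarrow> real) \<Rightarrow> (real^'n \<Rightarrow> complex) \<Rightarrow> (real^'n \<Rightarrow> complex) \<Rightarrow> bool" where
  "weak_solution \<Omega> A b1 b2 c w f \<longleftrightarrow>
     (\<exists>Du Dv. H10 \<Omega> (\<lambda>x. Re (w x)) Du \<and> H10 \<Omega> (\<lambda>x. Im (w x)) Dv \<and>
        (\<forall>\<phi>. test_function \<Omega> \<phi> \<longrightarrow>
           neg_L_form \<Omega> A b1 b2 c (\<lambda>x. Re (w x)) Du \<phi> = (LINT x|lebesgue_on \<Omega>. Re (f x) * \<phi> x) \<and>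
           neg_L_form \<Omega> A b1 b2 c (\<lambda>x. Im (w x)) Dv \<phi> = (LINT x|lebesgue_on \<Omega>. Im (f x) * \<phi> x)))"

definition eigenfunction ::
  "(real^'n) set \<Rightarrow> (real^'n \<Rightarrow> real^'n^'n) \<Rightarrow> (real^'n \<Rightarrow> real^'n) \<Rightarrow> (real^'n \<Rightarrow> real^'n) \<Rightarrow>
   (real^'n \<Rightarrow> real) \<Rightarrow> complex \<Rightarrow> (real^'n \<Rightarrow> complex) \<Rightarrow> bool" where
  "eigenfunction \<Omega> A b1 b2 c z w \<longleftrightarrow>
     weak_solution \<Omega> A b1 b2 c w (\<lambda>x. z * w x) \<and> \<not> (AE x in lebesgue_on \<Omega>. w x = 0)"

text \<open>Algebraic simplicity: the eigenspace is one-dimensional and there are no generalized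
  eigenfunctions, i.e. no eigenfunction \<open>w\<close> is of the form \<open>(-\<L> - z) v\<close>.\<close>

definition simple_eigenvalue ::
  "(real^'n) set \<Rightarrow> (real^'n \<Rightarrow> real^'n^'n) \<Rightarrow> (real^'n \<Rightarrow> real^'n) \<Rightarrow> (real^'n \<Rightarrow> real^'n) \<Rightarrow>
   (real^'n \<Rightarrow> real) \<Rightarrow> complex \<Rightarrow> bool" where
  "simple_eigenvalue \<Omega> A b1 b2 c z \<longleftrightarrow>
     (\<exists>w. eigenfunction \<Omega> A b1 b2 c z w) \<and>
     (\<forall>w w'. eigenfunction \<Omega> A b1 b2 c z w \<and> eigenfunction \<Omega> A b1 b2 c z w' \<longrightarrow>
        (\<exists>k. AE x in lebesgue_on \<Omega>. w' x = k * w x)) \<and>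
     (\<forall>w. eigenfunction \<Omega> A b1 b2 c z w \<longrightarrow>
        \<not> (\<exists>v. weak_solution \<Omega> A b1 b2 c v (\<lambda>x. z * v x + w x)))"

definition principal_eigenvalue ::
  "(real^'n) set \<Rightarrow> (real^'n \<Rightarrow> real^'n^'n) \<Rightarrow> (real^'n \<Rightarrow> real^'n) \<Rightarrow> (real^'n \<Rightarrow> real^'n) \<Rightarrow>
   (real^'n \<Rightarrow> real) \<Rightarrow> real \<Rightarrow> bool" where
  "principal_eigenvalue \<Omega> A b1 b2 c \<mu> \<longleftrightarrow>
     simple_eigenvalue \<Omega> A b1 b2 c (complex_of_real \<mu>) \<and>
     (\<forall>z w. eigenfunction \<Omega> A b1 b2 c z w \<longrightarrow> \<mu> \<le> Re z) \<and>
     (\<exists>\<phi>::real^'n \<Rightarrow> real. (AE x in lebesgue_on \<Omega>. \<phi> x > 0) \<and>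
        eigenfunction \<Omega> A b1 b2 c (complex_of_real \<mu>) (\<lambda>x. complex_of_real (\<phi> x)))"

lemma principal_eigenvalue_unique:
  assumes "principal_eigenvalue \<Omega> A b1 b2 c \<mu>" and "principal_eigenvalue \<Omega> A b1 b2 c \<nu>"
  shows "\<mu> = \<nu>"
  using assms unfolding principal_eigenvalue_def by (metis Re_complex_of_real order_antisym)

section \<open>The quantity bounding the eigenvalue\<close>

definition sigma :: "nat \<Rightarrow> ereal \<Rightarrow> real \<Rightarrow> real" where
  "sigma n q x =
     (if q = \<infinity> then x else max x (x powr (1 / (1 - real n / real_of_ereal q))))"

definition M1 ::
  "ereal \<Rightarrow> real \<Rightarrow> real \<Rightarrow> (real^'n \<Rightarrow> real^'n^'n) \<Rightarrow> (real^'n \<Rightarrow> real^'n) \<Rightarrow> (real^'n \<Rightarrow> real^'n) \<Rightarrow>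
   (real^'n \<Rightarrow> real) \<Rightarrow> real" where
  "M1 q \<alpha> R A b1 b2 c =
     holder_seminorm \<alpha> (ball 0 R) A powr (1 / \<alpha>)
     + holder_seminorm \<alpha> (ball 0 R) b1 powr (1 / (\<alpha> + 1))
     + Lq_norm \<infinity> (ball 0 R) b1
     + sigma CARD('n) q (Lq_ul_norm q R b2)
     + sigma CARD('n) (2 * q) (sqrt (Lq_ul_norm q R c))"

end

theory Submission
  imports Defs
begin

text \<open>
  The equation for the positive eigenfunction \<open>u\<close> is tested with \<open>\<phi>\<^sup>2 / u\<close>, where \<open>\<phi>\<close> is a cut-off
  function (Barta's method). The right-hand side of the equation becomes the eigenvalue times the
  integral of \<open>\<phi>\<^sup>2\<close>. On the left the derivative of \<open>1 / u\<close> produces a term bounded above by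
  \<open>- lam * \<phi>\<^sup>2 |\<nabla>u|\<^sup>2 / u\<^sup>2\<close>, which absorbs every other occurrence of \<open>\<nabla>u / u\<close>. Hence the eigenvalue
  times the integral of \<open>\<phi>\<^sup>2\<close> is at most a constant times the integral of
  \<open>|\<nabla>\<phi>|\<^sup>2 + (|b\<^sub>1|\<^sup>2 + |b\<^sub>2|\<^sup>2 + |c|) \<phi>\<^sup>2\<close>; this is \<open>eigenvalue_energy_bound\<close>.

  The absorption requires a bound on the matrix \<open>A\<close> where \<open>\<phi>\<close> does not vanish, but the ellipticity
  condition bounds only the quadratic form of \<open>A\<close>. The antisymmetric part of \<open>A 0\<close> is therefore
  subtracted first: as a constant antisymmetric matrix it does not change the weak equation
  (\<open>neg_L_form_diff_antisymmetric\<close>), since second derivatives of test functions commute. What is left is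
  the symmetric part of \<open>A 0\<close>, which ellipticity does control, and the oscillation of \<open>A\<close>, which is
  at most 1 on a ball whose radius is given by the Hoelder seminorm.

  Now let \<open>\<phi>\<close> be a bump of radius \<open>\<rho> = 1 / (2 (M\<^sub>1 + 1 / R))\<close>. All terms of \<open>M\<^sub>1\<close> scale like an
  inverse length. In particular the function \<open>sigma\<close> is made such that the averages of \<open>|b\<^sub>2|\<^sup>2\<close> and
  \<open>|c|\<close> over the ball of radius \<open>\<rho>\<close> are \<open>O(1 / \<rho>\<^sup>2)\<close> (\<open>integral_ball_powr_le\<close>). Every term of the
  energy estimate is then \<open>O(1 / \<rho>\<^sup>2)\<close> relative to the integral of \<open>\<phi>\<^sup>2\<close>, which is the claim.

  Only smooth test functions are admitted, so \<open>1 / u\<close> is replaced by a smooth bounded function of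
  \<open>u\<close>, and \<open>u\<close> inside it by the test functions that approximate it (\<open>weak_form_soft_recip\<close>).
\<close>

section \<open>Smooth functions\<close>

lemma gradient_eqI:
  assumes "(f has_derivative (\<lambda>h. g \<bullet> h)) (at x)"
  shows "gradient f x = g"
proof -
  have "frechet_derivative f (at x) = (\<lambda>h. g \<bullet> h)"
    using assms frechet_derivative_at by metis
  then show ?thesis
    by (simp add: gradient_def vec_eq_iff inner_axis)
qed

lemma has_derivative_gradient:
  fixes f :: "real^'n \<Rightarrow> real"
  assumes "f differentiable (at x)"
  shows "(f has_derivative (\<lambda>h. gradient f x \<bullet> h)) (at x)"
proof -
  let ?D = "frechet_derivative f (at x)"
  have D: "(f has_derivative ?D) (at x)"
    using assms frechet_derivative_works by blast
  then interpret linear ?D by (rule has_derivative_linear)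
  have "?D h = gradient f x \<bullet> h" for h
  proof -
    have "?D h = ?D (\<Sum>i\<in>UNIV. h $ i *\<^sub>R axis i 1)"
      using basis_expansion[of h] by (simp add: scalar_mult_eq_scaleR)
    also have "\<dots> = (\<Sum>i\<in>UNIV. h $ i * ?D (axis i 1))"
      by (simp add: sum scale)
    also have "\<dots> = gradient f x \<bullet> h"
      by (simp add: gradient_def inner_vec_def mult.commute)
    finally show ?thesis .
  qed
  then have "?D = (\<lambda>h. gradient f x \<bullet> h)" by auto
  with D show ?thesis by simp
qed

lemma Ck_differentiable:
  "Ck (Suc k) f \<Longrightarrow> f differentiable (at x)"
  by (simp add: differentiable_on_def)

lemma Ck_SucI:
  assumes "\<And>x. (f has_derivative (\<lambda>h. g x \<bullet> h)) (at x)"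
    and "\<And>i. Ck k (\<lambda>x. g x $ i)"
  shows "Ck (Suc k) f"
proof -
  have "gradient f = g"
    using gradient_eqI[OF assms(1)] by auto
  moreover have "f differentiable_on UNIV"
    using assms(1) by (auto simp: differentiable_on_def differentiable_def)
  ultimately show ?thesis using assms(2) by simp
qed

lemma Ck_Suc_D: "Ck (Suc k) f \<Longrightarrow> Ck k f"
proof (induction k arbitrary: f)
  case 0
  then show ?case by (simp add: differentiable_imp_continuous_on)
next
  case (Suc k)
  then show ?case by (metis Ck.simps(2))
qed

lemma Ck_continuous: "Ck k f \<Longrightarrow> continuous_on UNIV f"
  by (induction k arbitrary: f) (auto simp: differentiable_imp_continuous_on)

lemma Ck_const: "Ck k (\<lambda>x. c)"
proof (induction k arbitrary: c)
  case (Suc k)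
  show ?case
    by (rule Ck_SucI[where g="\<lambda>x. 0"]) (use Suc in auto)
qed auto

lemma Ck_add: "Ck k f \<Longrightarrow> Ck k g \<Longrightarrow> Ck k (\<lambda>x. f x + g x)"
proof (induction k arbitrary: f g)
  case 0
  then show ?case by (auto intro: continuous_on_add)
next
  case (Suc k)
  show ?case
    by (rule Ck_SucI[where g="\<lambda>x. gradient f x + gradient g x"])
      (use Suc in \<open>auto simp: inner_left_distrib differentiable_on_def
         intro!: has_derivative_add has_derivative_gradient\<close>)
qed

lemma Ck_mult: "Ck k f \<Longrightarrow> Ck k g \<Longrightarrow> Ck k (\<lambda>x. f x * g x)"
proof (induction k arbitrary: f g)
  case 0
  then show ?case by (auto intro: continuous_on_mult)
next
  case (Suc k)
  show ?case
  proof (rule Ck_SucI)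
    show "((\<lambda>x. f x * g x) has_derivative (\<lambda>h. (f x *\<^sub>R gradient g x + g x *\<^sub>R gradient f x) \<bullet> h)) (at x)" for x
      by (rule has_derivative_eq_rhs[OF has_derivative_mult[OF has_derivative_gradient has_derivative_gradient]])
        (use Suc.prems Ck_differentiable in \<open>auto simp: algebra_simps inner_left_distrib\<close>)
    show "Ck k (\<lambda>x. (f x *\<^sub>R gradient g x + g x *\<^sub>R gradient f x) $ i)" for i
      using Suc.prems Ck_Suc_D[OF Suc.prems(1)] Ck_Suc_D[OF Suc.prems(2)]
      by (auto intro!: Ck_add Suc.IH)
  qed
qed

lemma has_derivative_compose_gradient:
  fixes g :: "real^'n \<Rightarrow> real"
  assumes "(F has_real_derivative d) (at (g x))" and "g differentiable (at x)"
  shows "((\<lambda>x. F (g x)) has_derivative (\<lambda>h. (d *\<^sub>R gradient g x) \<bullet> h)) (at x)"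
proof -
  have "((\<lambda>x. F (g x)) has_derivative (\<lambda>h. (gradient g x \<bullet> h) * d)) (at x)"
    by (rule DERIV_compose_FDERIV[OF assms(1) has_derivative_gradient[OF assms(2)]])
  then show ?thesis by (simp add: mult.commute)
qed

text \<open>One step of the chain rule. The families that are needed below (reciprocals, square roots, the
  flat exponentials) have derivatives in the algebra that they generate, so that smoothness of
  compositions with them follows from this step by induction on the order.\<close>

lemma Ck_Suc_compose:
  assumes "\<And>x. (F has_real_derivative F' (g x)) (at (g x))"
    and "Ck k (\<lambda>x. F' (g x))" and "Ck (Suc k) g"
  shows "Ck (Suc k) (\<lambda>x. F (g x))"
proof (rule Ck_SucI)
  show "((\<lambda>x. F (g x)) has_derivative (\<lambda>h. (F' (g x) *\<^sub>R gradient g x) \<bullet> h)) (at x)" for x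
    by (rule has_derivative_compose_gradient[OF assms(1) Ck_differentiable[OF assms(3)]])
  show "Ck k (\<lambda>x. (F' (g x) *\<^sub>R gradient g x) $ i)" for i
    using assms by (auto intro!: Ck_mult)
qed

lemma Ck_inverse: "Ck k f \<Longrightarrow> (\<And>x. f x > 0) \<Longrightarrow> Ck k (\<lambda>x. inverse (f x))"
proof (induction k arbitrary: f)
  case 0
  then show ?case
    by (auto intro!: continuous_on_inverse simp: less_imp_neq[symmetric])
next
  case (Suc k)
  have k: "Ck k (\<lambda>x. inverse (f x))"
    using Suc Ck_Suc_D by blast
  show ?case
  proof (rule Ck_Suc_compose[where F = inverse])
    show "(inverse has_real_derivative - 1 * (inverse (f x) * inverse (f x))) (at (f x))" for x
      using Suc.prems(2)[of x] by (auto intro!: derivative_eq_intros)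
    show "Ck k (\<lambda>x. - 1 * (inverse (f x) * inverse (f x)))"
      by (intro Ck_mult k Ck_const)
  qed (use Suc in auto)
qed

lemma Ck_sqrt: "Ck k f \<Longrightarrow> (\<And>x. f x > 0) \<Longrightarrow> Ck k (\<lambda>x. sqrt (f x))"
proof (induction k arbitrary: f)
  case 0
  then show ?case by (auto intro!: continuous_on_real_sqrt)
next
  case (Suc k)
  have k: "Ck k (\<lambda>x. sqrt (f x))"
    using Suc Ck_Suc_D by blast
  show ?case
  proof (rule Ck_Suc_compose[where F = sqrt])
    show "(sqrt has_real_derivative (1/2) * inverse (sqrt (f x))) (at (f x))" for x
      using Suc.prems(2)[of x] by (auto intro!: derivative_eq_intros simp: field_simps)
    show "Ck k (\<lambda>x. (1/2) * inverse (sqrt (f x)))"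
      by (intro Ck_mult Ck_const Ck_inverse k) (use Suc in auto)
  qed (use Suc in auto)
qed

lemma Ck_inner_self: "Ck k (\<lambda>x::real^'n. x \<bullet> x)"
proof -
  have comp: "Ck k (\<lambda>x::real^'n. x $ i)" for k i
  proof (cases k)
    case (Suc m)
    have "((\<lambda>x::real^'n. x $ i) has_derivative (\<lambda>h. axis i 1 \<bullet> h)) (at x)" for x
      by (rule has_derivative_eq_rhs[OF bounded_linear.has_derivative[OF bounded_linear_vec_nth has_derivative_ident]])
        (auto simp: inner_axis inner_commute)
    then show ?thesis
      unfolding Suc by (rule Ck_SucI) (simp add: Ck_const)
  qed (auto intro!: continuous_intros)
  show ?thesis
  proof (cases k)
    case (Suc m)
    have "((\<lambda>x::real^'n. x \<bullet> x) has_derivative (\<lambda>h. (2 *\<^sub>R x) \<bullet> h)) (at x)" for x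
      by (auto intro!: derivative_eq_intros simp: inner_commute)
    then show ?thesis
      unfolding Suc by (rule Ck_SucI) (auto intro!: Ck_mult Ck_const comp)
  qed (auto intro!: continuous_intros)
qed

text \<open>The function \<open>t\<^sup>-\<^sup>m exp (- 1 / t)\<close>, extended by 0 to \<open>t \<le> 0\<close>. The parameter \<open>m\<close>
  makes the family closed under differentiation, up to linear combinations.\<close>

definition flat_exp :: "nat \<Rightarrow> real \<Rightarrow> real" where
  "flat_exp m t = (if t > 0 then inverse t ^ m * exp (- inverse t) else 0)"

lemma flat_exp_tendsto_0: "(flat_exp m \<longlongrightarrow> 0) (at 0)"
proof -
  have "((\<lambda>t::real. inverse t ^ m * exp (- inverse t)) \<longlongrightarrow> 0) (at_right 0)"
  proof -
    have "((\<lambda>s::real. s ^ m / exp s) \<longlongrightarrow> 0) at_top"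
      by (rule tendsto_power_div_exp_0)
    from filterlim_compose[OF this filterlim_inverse_at_top_right] show ?thesis
      by (simp add: exp_minus divide_inverse)
  qed
  then have r: "(flat_exp m \<longlongrightarrow> 0) (at_right 0)"
    by (rule Lim_transform_eventually)
      (auto simp: flat_exp_def eventually_at_right_less intro!: eventually_at_rightI[of 0 1])
  have l: "(flat_exp m \<longlongrightarrow> 0) (at_left 0)"
    by (rule Lim_transform_eventually[OF tendsto_const])
      (auto simp: flat_exp_def intro!: eventually_at_leftI[of "-1" 0])
  from l r show ?thesis by (simp add: filterlim_split_at)
qed

text \<open>At 0 the difference quotient of \<open>flat_exp m\<close> is \<open>flat_exp (m + 1)\<close>, which tends to 0 because the
  exponential beats every power.\<close>

lemma flat_exp_deriv:
  "(flat_exp m has_real_derivative flat_exp (m + 2) t - m * flat_exp (m + 1) t) (at t)"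
proof -
  consider "t < 0" | "t = 0" | "t > 0" by linarith
  then show ?thesis
  proof cases
    case 1
    have "((\<lambda>_. 0) has_real_derivative 0) (at t)" by simp
    then have "(flat_exp m has_real_derivative 0) (at t)"
      by (rule has_field_derivative_transform_within_open[where S="{..<0}"])
        (use 1 in \<open>auto simp: flat_exp_def\<close>)
    then show ?thesis using 1 by (simp add: flat_exp_def)
  next
    case 2
    have "flat_exp m h / h = flat_exp (m + 1) h" for h
      by (simp add: flat_exp_def field_simps)
    then have "(flat_exp m has_real_derivative 0) (at 0)"
      using flat_exp_tendsto_0[of "m+1"] unfolding has_field_derivative_iff
      by (simp add: flat_exp_def[of _ 0])
    then show ?thesis using 2 by (simp add: flat_exp_def)
  next
    case 3
    have "((\<lambda>t. inverse t ^ m * exp (- inverse t)) has_real_derivative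
        flat_exp (m + 2) t - m * flat_exp (m + 1) t) (at t)"
    proof (cases m)
      case 0
      then show ?thesis using 3
        by (auto intro!: derivative_eq_intros simp: flat_exp_def power2_eq_square)
    next
      case (Suc k)
      have "((\<lambda>t. inverse t ^ m) has_real_derivative - (m * inverse t ^ (m + 1))) (at t)"
        unfolding Suc
        by (rule DERIV_cong[OF DERIV_power_Suc[OF DERIV_inverse]]) (use 3 in auto)
      moreover have "((\<lambda>t. exp (- inverse t)) has_real_derivative inverse t ^ 2 * exp (- inverse t)) (at t)"
        using 3 by (auto intro!: derivative_eq_intros simp: power2_eq_square)
      ultimately show ?thesis using 3
        by (auto intro!: DERIV_mult[THEN DERIV_cong] simp: flat_exp_def algebra_simps power2_eq_square)
    qed
    then show ?thesis
      by (rule has_field_derivative_transform_within_open[where S="{0<..}"])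
        (use 3 in \<open>auto simp: flat_exp_def\<close>)
  qed
qed

lemma Ck_flat_exp: "Ck k g \<Longrightarrow> Ck k (\<lambda>x. flat_exp m (g x))"
proof (induction k arbitrary: m)
  case 0
  have "continuous_on UNIV (flat_exp m)"
    using flat_exp_deriv DERIV_isCont by (metis continuous_at_imp_continuous_on)
  then show ?case
    using 0 by (auto intro: continuous_on_compose2)
next
  case (Suc k)
  show ?case
  proof (rule Ck_Suc_compose[where F = "flat_exp m" and g = g and F' = "\<lambda>t. flat_exp (m + 2) t + (- real m) * flat_exp (m + 1) t"])
    show "(flat_exp m has_real_derivative
        flat_exp (m + 2) (g x) + (- real m) * flat_exp (m + 1) (g x)) (at (g x))" for x
      using flat_exp_deriv[of m "g x"] by simp
    show "Ck k (\<lambda>x. flat_exp (m + 2) (g x) + (- real m) * flat_exp (m + 1) (g x))"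
      using Suc Ck_Suc_D by (intro Ck_add Ck_mult Ck_const Suc.IH) blast+
  qed (use Suc in auto)
qed

lemma gradient_mult:
  assumes "f differentiable (at x)" and "g differentiable (at x)"
  shows "gradient (\<lambda>x. f x * g x) x = f x *\<^sub>R gradient g x + g x *\<^sub>R gradient f x"
  by (rule gradient_eqI, rule has_derivative_eq_rhs[OF has_derivative_mult[OF
        has_derivative_gradient[OF assms(1)] has_derivative_gradient[OF assms(2)]]])
    (auto simp: algebra_simps inner_left_distrib)

lemma gradient_compose:
  assumes "(F has_real_derivative d) (at (g x))" and "g differentiable (at x)"
  shows "gradient (\<lambda>x. F (g x)) x = d *\<^sub>R gradient g x"
  by (rule gradient_eqI) (rule has_derivative_compose_gradient[OF assms])

lemma DERIV_along_axis:
  fixes g :: "real^'n \<Rightarrow> real"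
  assumes "g differentiable (at (y + s *\<^sub>R axis i 1))"
  shows "((\<lambda>s. g (y + s *\<^sub>R axis i 1)) has_real_derivative gradient g (y + s *\<^sub>R axis i 1) $ i) (at s)"
proof -
  have "((\<lambda>s. g (y + s *\<^sub>R axis i 1)) has_derivative
      (\<lambda>h. gradient g (y + s *\<^sub>R axis i 1) \<bullet> (h *\<^sub>R axis i 1))) (at s)"
    by (rule has_derivative_compose[where f = "\<lambda>s. y + s *\<^sub>R axis i 1" and g = g, OF _ has_derivative_gradient[OF assms]])
      (auto intro!: derivative_eq_intros)
  then show ?thesis
    by (simp add: has_field_derivative_def inner_axis mult.commute[of _ "gradient _ _ $ _"])
qed

text \<open>The mean value theorem, applied first in direction \<open>i\<close> and then in direction \<open>j\<close>. The left-hand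
  side is symmetric in \<open>i\<close> and \<open>j\<close>, which forces the symmetry of second derivatives.\<close>

lemma second_difference:
  fixes f :: "real^'n \<Rightarrow> real"
  assumes "Ck 2 f" and "t > 0"
  shows "\<exists>z. dist z x \<le> 2 * t \<and>
    f (x + t *\<^sub>R axis j 1 + t *\<^sub>R axis i 1) - f (x + t *\<^sub>R axis j 1) - f (x + t *\<^sub>R axis i 1) + f x
      = t\<^sup>2 * gradient (\<lambda>x. gradient f x $ i) z $ j"
proof -
  have d: "f differentiable (at x)" "(\<lambda>x. gradient f x $ i) differentiable (at x)" for x
    using assms(1) by (auto simp: numeral_2_eq_2 differentiable_on_def)
  let ?h = "\<lambda>s. f (x + t *\<^sub>R axis j 1 + s *\<^sub>R axis i 1) - f (x + s *\<^sub>R axis i 1)"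
  obtain \<sigma> where s: "0 < \<sigma>" "\<sigma> < t" and "?h t - ?h 0 = (t - 0) *
      (gradient f (x + t *\<^sub>R axis j 1 + \<sigma> *\<^sub>R axis i 1) $ i - gradient f (x + \<sigma> *\<^sub>R axis i 1) $ i)"
    using MVT2[OF assms(2), of ?h "\<lambda>s. gradient f (x + t *\<^sub>R axis j 1 + s *\<^sub>R axis i 1) $ i
        - gradient f (x + s *\<^sub>R axis i 1) $ i", OF DERIV_diff[OF DERIV_along_axis DERIV_along_axis, OF d(1) d(1)]]
    by blast
  moreover let ?k = "\<lambda>s. gradient f (x + \<sigma> *\<^sub>R axis i 1 + s *\<^sub>R axis j 1) $ i"
  obtain \<tau> where t: "0 < \<tau>" "\<tau> < t" and "?k t - ?k 0 = (t - 0) *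
      gradient (\<lambda>x. gradient f x $ i) (x + \<sigma> *\<^sub>R axis i 1 + \<tau> *\<^sub>R axis j 1) $ j"
    using MVT2[OF assms(2), of ?k, OF DERIV_along_axis[OF d(2)]] by blast
  ultimately have "?h t - ?h 0 = t\<^sup>2 *
      gradient (\<lambda>x. gradient f x $ i) (x + \<sigma> *\<^sub>R axis i 1 + \<tau> *\<^sub>R axis j 1) $ j"
    by (simp add: power2_eq_square algebra_simps)
  moreover have "dist (x + \<sigma> *\<^sub>R axis i 1 + \<tau> *\<^sub>R axis j 1) x \<le> 2 * t"
  proof -
    have "norm (\<sigma> *\<^sub>R axis i 1 + \<tau> *\<^sub>R (axis j 1 :: real^'n)) \<le> \<sigma> + \<tau>"
      using norm_triangle_ineq[of "\<sigma> *\<^sub>R axis i 1" "\<tau> *\<^sub>R (axis j 1 :: real^'n)"] s t by simp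
    then show ?thesis using s t by (simp add: dist_norm algebra_simps)
  qed
  ultimately show ?thesis by (intro exI conjI) (auto simp: algebra_simps)
qed

text \<open>Schwarz's theorem: divide the two representations of the second difference by \<open>t\<^sup>2\<close> and let \<open>t\<close>
  tend to 0.\<close>

lemma gradient_gradient_commute:
  fixes f :: "real^'n \<Rightarrow> real"
  assumes "Ck 2 f"
  shows "gradient (\<lambda>x. gradient f x $ i) x $ j = gradient (\<lambda>x. gradient f x $ j) x $ i"
proof -
  let ?D = "\<lambda>i j z. gradient (\<lambda>x. gradient f x $ i) z $ j"
  have "\<exists>z z'. dist z x \<le> 2 / Suc n \<and> dist z' x \<le> 2 / Suc n \<and> ?D i j z = ?D j i z'" for n
    using second_difference[OF assms, of "1 / Suc n" x j i] second_difference[OF assms, of "1 / Suc n" x i j]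
    by (auto simp: algebra_simps) (smt (verit, best) mult_cancel_left of_nat_0_less_iff zero_less_Suc
         zero_less_divide_1_iff power_eq_0_iff)
  then obtain z z' where z: "\<And>n. dist (z n) x \<le> 2 / Suc n" "\<And>n. dist (z' n) x \<le> 2 / Suc n"
    and eq: "\<And>n. ?D i j (z n) = ?D j i (z' n)"
    by metis
  have lim: "(\<lambda>n. ?D a b (y n)) \<longlonglongrightarrow> ?D a b x" if "\<And>n. dist (y n) x \<le> 2 / Suc n" for a b y
  proof -
    have "(\<lambda>n. 2 / Suc n) \<longlonglongrightarrow> (0::real)"
      using tendsto_mult_right_zero[OF LIMSEQ_inverse_real_of_nat, of 2] by (simp add: divide_inverse)
    then have "y \<longlonglongrightarrow> x"
      by (rule metric_tendsto_imp_tendsto) (use that in auto)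
    moreover have "continuous_on UNIV (?D a b)"
      using assms by (auto simp: numeral_2_eq_2)
    ultimately show ?thesis
      using isCont_tendsto_compose[of x "?D a b" y] by (simp add: continuous_on_eq_continuous_at)
  qed
  show ?thesis
    using lim[of z i j, OF z(1)] lim[of z' j i, OF z(2)] eq LIMSEQ_unique by simp
qed

section \<open>Test functions\<close>

lemma test_function_mult:
  assumes "test_function \<Omega> \<phi>" and "\<And>k. Ck k g"
  shows "test_function \<Omega> (\<lambda>x. \<phi> x * g x)"
proof -
  have "closure {x. \<phi> x * g x \<noteq> 0} \<subseteq> closure {x. \<phi> x \<noteq> 0}"
    by (rule closure_mono) auto
  moreover from this have "compact (closure {x. \<phi> x * g x \<noteq> 0})"
    using assms(1) compact_Int_closed[of "closure {x. \<phi> x \<noteq> 0}" "closure {x. \<phi> x * g x \<noteq> 0}"]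
    by (simp add: test_function_def inf.absorb2)
  ultimately show ?thesis
    using assms by (auto simp: test_function_def Ck_mult)
qed

lemma gradient_eq_0_outside_support:
  assumes "x \<notin> closure {x. \<phi> x \<noteq> 0}"
  shows "gradient \<phi> x = 0"
proof (rule gradient_eqI)
  show "(\<phi> has_derivative (\<lambda>h. 0 \<bullet> h)) (at x)"
    by (rule has_derivative_transform_within_open[of "\<lambda>_. 0" _ _ _ "- closure {x. \<phi> x \<noteq> 0}"])
      (use assms closure_subset[of "{x. \<phi> x \<noteq> 0}"] in auto)
qed

lemma test_function_gradient:
  assumes "test_function \<Omega> \<phi>"
  shows "test_function \<Omega> (\<lambda>x. gradient \<phi> x $ i)"
proof -
  have "closure {x. gradient \<phi> x $ i \<noteq> 0} \<subseteq> closure {x. \<phi> x \<noteq> 0}"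
    using gradient_eq_0_outside_support[of _ \<phi>] by (intro closure_minimal) force+
  moreover from this have "compact (closure {x. gradient \<phi> x $ i \<noteq> 0})"
    using assms compact_Int_closed[of "closure {x. \<phi> x \<noteq> 0}" "closure {x. gradient \<phi> x $ i \<noteq> 0}"]
    by (simp add: test_function_def inf.absorb2)
  moreover have "Ck k (\<lambda>x. gradient \<phi> x $ i)" for k
    using assms Ck.simps(2)[of k \<phi>] unfolding test_function_def by blast
  ultimately show ?thesis
    using assms by (auto simp: test_function_def)
qed

lemma test_function_bounded:
  assumes "test_function \<Omega> \<phi>"
  obtains B where "B > 0" and "\<And>x. \<bar>\<phi> x\<bar> \<le> B"
proof -
  have c: "continuous_on UNIV \<phi>" and K: "compact (closure {x. \<phi> x \<noteq> 0})"
    using assms Ck_continuous by (auto simp: test_function_def)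
  have "bounded (\<phi> ` closure {x. \<phi> x \<noteq> 0})"
    by (intro compact_imp_bounded compact_continuous_image K continuous_on_subset[OF c]) auto
  then obtain B where B: "B > 0" "\<And>x. x \<in> closure {x. \<phi> x \<noteq> 0} \<Longrightarrow> \<bar>\<phi> x\<bar> \<le> B"
    by (auto simp: bounded_pos)
  have "\<bar>\<phi> x\<bar> \<le> B" for x
    using B closure_subset[of "{x. \<phi> x \<noteq> 0}"] by (cases "\<phi> x = 0") auto
  with B(1) that show ?thesis by blast
qed

lemma test_function_gradient_bounded:
  fixes \<phi> :: "real^'n \<Rightarrow> real"
  assumes "test_function \<Omega> \<phi>"
  obtains B where "B > 0" and "\<And>x. norm (gradient \<phi> x) \<le> B"
proof -
  have "\<exists>B>0. \<forall>x. \<bar>gradient \<phi> x $ i\<bar> \<le> B" for i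
    using test_function_bounded[OF test_function_gradient[OF assms, of i]] by metis
  then obtain B where B: "\<And>i. B i > 0" "\<And>i x. \<bar>gradient \<phi> x $ i\<bar> \<le> B i"
    by metis
  have "norm (gradient \<phi> x) \<le> sum B UNIV" for x
    by (rule order_trans[OF norm_le_l1_cart]) (auto intro: sum_mono B)
  moreover have "sum B UNIV > 0" by (auto intro: sum_pos B)
  ultimately show ?thesis using that by blast
qed

text \<open>A cut-off function with support in the closed ball of radius \<open>\<rho>\<close>. It is given by an explicit
  formula so that its size and the size \<open>O(1 / \<rho>)\<close> of its gradient can be read off for all \<open>\<rho>\<close> at
  once.\<close>

definition bump :: "real \<Rightarrow> real^'n \<Rightarrow> real" where
  "bump \<rho> x = flat_exp 0 (1 - inverse (\<rho>\<^sup>2) * (x \<bullet> x))"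

lemma bump_nonneg: "bump \<rho> x \<ge> 0" and bump_le_1: "bump \<rho> x \<le> 1"
  by (auto simp: bump_def flat_exp_def)

lemma bump_eq_0_iff: "\<rho> > 0 \<Longrightarrow> bump \<rho> x = 0 \<longleftrightarrow> \<rho> \<le> norm x"
proof -
  assume "\<rho> > 0"
  then have "1 - inverse (\<rho>\<^sup>2) * (x \<bullet> x) > 0 \<longleftrightarrow> (norm x)\<^sup>2 < \<rho>\<^sup>2"
    by (simp add: power2_norm_eq_inner field_simps)
  also have "\<dots> \<longleftrightarrow> norm x < \<rho>"
  proof
    show "norm x < \<rho>" if "(norm x)\<^sup>2 < \<rho>\<^sup>2"
      using that \<open>\<rho> > 0\<close> by (simp add: power2_less_imp_less)
    show "(norm x)\<^sup>2 < \<rho>\<^sup>2" if "norm x < \<rho>"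
      using that by (simp add: power_strict_mono)
  qed
  finally show ?thesis by (auto simp: bump_def flat_exp_def)
qed

lemma test_function_bump:
  fixes \<Omega> :: "(real^'n) set"
  assumes "\<rho> > 0" and "cball 0 \<rho> \<subseteq> \<Omega>"
  shows "test_function \<Omega> (bump \<rho>)"
proof -
  have "{x. bump \<rho> x \<noteq> 0} = ball (0::real^'n) \<rho>"
    by (simp add: set_eq_iff bump_eq_0_iff[OF assms(1)] not_le)
  moreover have "Ck k (bump \<rho> :: real^'n \<Rightarrow> real)" for k
  proof -
    have "Ck k (\<lambda>x::real^'n. flat_exp 0 (1 + (- inverse (\<rho>\<^sup>2)) * (x \<bullet> x)))"
      by (intro Ck_flat_exp Ck_add Ck_mult Ck_const Ck_inner_self)
    then show ?thesis by (simp add: bump_def[abs_def])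
  qed
  ultimately show ?thesis
    using assms by (simp add: test_function_def)
qed

lemma flat_exp_2_bounds: "0 \<le> flat_exp 2 t" "flat_exp 2 t \<le> 2"
proof -
  show "0 \<le> flat_exp 2 t" by (simp add: flat_exp_def)
  have "s\<^sup>2 * exp (- s) \<le> 2" if "s > 0" for s :: real
  proof -
    have "s\<^sup>2 \<le> 2 * exp s"
      using exp_lower_Taylor_quadratic[of s] that by (simp add: field_simps)
    then show ?thesis by (simp add: exp_minus field_simps)
  qed
  then show "flat_exp 2 t \<le> 2"
    using positive_imp_inverse_positive[of t] by (auto simp: flat_exp_def simp del: power_inverse)
qed

lemma norm_gradient_bump_le:
  assumes "\<rho> > 0"
  shows "norm (gradient (bump \<rho>) (x::real^'n)) \<le> 4 / \<rho>"
    and "norm x \<ge> \<rho> \<Longrightarrow> gradient (bump \<rho>) x = 0"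
proof -
  let ?g = "\<lambda>x::real^'n. 1 - inverse (\<rho>\<^sup>2) * (x \<bullet> x)"
  have g: "(?g has_derivative (\<lambda>h. (- 2 * inverse (\<rho>\<^sup>2)) *\<^sub>R x \<bullet> h)) (at x)"
    by (auto intro!: derivative_eq_intros simp: inner_commute)
  then have "?g differentiable (at x)" by (auto simp: differentiable_def)
  from gradient_compose[OF flat_exp_deriv[of 0] this]
  have eq: "gradient (bump \<rho>) x = flat_exp 2 (?g x) *\<^sub>R (- 2 * inverse (\<rho>\<^sup>2)) *\<^sub>R x"
    by (simp add: bump_def[abs_def] gradient_eqI[OF g] numeral_2_eq_2[symmetric])
  show *: "gradient (bump \<rho>) x = 0" if "norm x \<ge> \<rho>"
  proof -
    have "(norm x)\<^sup>2 \<ge> \<rho>\<^sup>2" using that assms by (intro power_mono) auto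
    then have "?g x \<le> 0" using assms by (simp add: power2_norm_eq_inner field_simps)
    then show ?thesis unfolding eq by (simp add: flat_exp_def)
  qed
  show "norm (gradient (bump \<rho>) x) \<le> 4 / \<rho>"
  proof (cases "norm x \<ge> \<rho>")
    case True
    then show ?thesis using * assms by simp
  next
    case False
    have "norm (gradient (bump \<rho>) x) = flat_exp 2 (?g x) * (2 * inverse (\<rho>\<^sup>2) * norm x)"
      unfolding eq using flat_exp_2_bounds by (simp add: abs_mult)
    also have "\<dots> \<le> 2 * (2 * inverse (\<rho>\<^sup>2) * \<rho>)"
      by (intro mult_mono flat_exp_2_bounds) (use False assms in \<open>auto simp: flat_exp_2_bounds\<close>)
    also have "\<dots> = 4 / \<rho>" using assms by (simp add: power2_eq_square field_simps)
    finally show ?thesis .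
  qed
qed

lemma bump_ge:
  assumes "\<rho> > 0" and "norm x \<le> \<rho> / 2"
  shows "bump \<rho> x \<ge> exp (-2)"
proof -
  have "(norm x)\<^sup>2 \<le> (\<rho> / 2)\<^sup>2" using assms by (intro power_mono) auto
  then have "1 - inverse (\<rho>\<^sup>2) * (x \<bullet> x) \<ge> 1/2"
    using assms(1) inner_ge_zero[of x]
    by (simp add: power2_norm_eq_inner field_simps power_divide del: inner_ge_zero)
  then show ?thesis
    using le_imp_inverse_le[of "1/2" "1 - inverse (\<rho>\<^sup>2) * (x \<bullet> x)"]
    by (auto simp: bump_def flat_exp_def)
qed

section \<open>A regularised reciprocal\<close>

text \<open>The function \<open>t \<mapsto> 1 / t\<close> is replaced by a function that is smooth and bounded on the whole line,
  because the test functions that approximate a positive \<open>u\<close> need not be positive themselves. The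
  denominator \<open>\<epsilon> + t + sqrt (\<epsilon>\<^sup>2 + t\<^sup>2)\<close> exceeds \<open>\<epsilon>\<close> everywhere and is close to \<open>2 * t\<close> for
  small \<open>\<epsilon>\<close> and positive \<open>t\<close>, so that the limit is in fact \<open>1 / (2 * t)\<close>.\<close>

definition soft_recip :: "real \<Rightarrow> real \<Rightarrow> real" where
  "soft_recip \<epsilon> t = inverse (\<epsilon> + t + sqrt (\<epsilon>\<^sup>2 + t\<^sup>2))"

definition soft_recip' :: "real \<Rightarrow> real \<Rightarrow> real" where
  "soft_recip' \<epsilon> t = - (1 + t / sqrt (\<epsilon>\<^sup>2 + t\<^sup>2)) * (soft_recip \<epsilon> t)\<^sup>2"

lemma soft_recip_denominator:
  fixes \<epsilon> t :: real
  assumes "\<epsilon> > 0"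
  shows "t + sqrt (\<epsilon>\<^sup>2 + t\<^sup>2) > 0" and "\<bar>t / sqrt (\<epsilon>\<^sup>2 + t\<^sup>2)\<bar> \<le> 1" and "sqrt (\<epsilon>\<^sup>2 + t\<^sup>2) > 0"
proof -
  have "\<bar>t\<bar> < sqrt (\<epsilon>\<^sup>2 + t\<^sup>2)"
    using assms by (intro real_less_rsqrt) auto
  moreover from this show "sqrt (\<epsilon>\<^sup>2 + t\<^sup>2) > 0"
    by (rule order_le_less_trans[OF abs_ge_zero])
  ultimately show "t + sqrt (\<epsilon>\<^sup>2 + t\<^sup>2) > 0" "\<bar>t / sqrt (\<epsilon>\<^sup>2 + t\<^sup>2)\<bar> \<le> 1"
    by (auto simp del: real_sqrt_gt_0_iff)
qed

lemma soft_recip_bounds: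
  assumes "\<epsilon> > 0"
  shows "0 < soft_recip \<epsilon> t" and "soft_recip \<epsilon> t \<le> 1 / \<epsilon>" and "\<bar>soft_recip' \<epsilon> t\<bar> \<le> 2 / \<epsilon>\<^sup>2"
proof -
  note d = soft_recip_denominator[OF assms, of t]
  show pos: "0 < soft_recip \<epsilon> t" using d assms by (simp add: soft_recip_def)
  show le: "soft_recip \<epsilon> t \<le> 1 / \<epsilon>"
    using d assms by (auto simp: soft_recip_def inverse_eq_divide intro!: divide_left_mono)
  have "\<bar>soft_recip' \<epsilon> t\<bar> \<le> 2 * (1 / \<epsilon>)\<^sup>2"
    unfolding soft_recip'_def abs_mult
  proof (rule mult_mono)
    show "\<bar>- (1 + t / sqrt (\<epsilon>\<^sup>2 + t\<^sup>2))\<bar> \<le> 2" using d(2) by linarith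
    show "\<bar>(soft_recip \<epsilon> t)\<^sup>2\<bar> \<le> (1 / \<epsilon>)\<^sup>2"
      using pos le by (simp add: power_mono del: power_divide)
  qed auto
  then show "\<bar>soft_recip' \<epsilon> t\<bar> \<le> 2 / \<epsilon>\<^sup>2" by (simp add: power_divide)
qed

text \<open>On the positive half-line the regularisation keeps the two features of \<open>G(t) = 1 / t\<close> that the
  energy estimate uses: \<open>G'\<close> is comparable to \<open>- G\<^sup>2\<close>, and \<open>t * G(t)\<close> is bounded, both uniformly in
  \<open>\<epsilon>\<close>.\<close>

lemma soft_recip_bounds_nonneg:
  assumes "\<epsilon> > 0" and "t \<ge> 0"
  shows "soft_recip' \<epsilon> t \<le> - (soft_recip \<epsilon> t)\<^sup>2" and "\<bar>soft_recip' \<epsilon> t\<bar> \<le> 2 * (soft_recip \<epsilon> t)\<^sup>2"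
    and "0 \<le> t * soft_recip \<epsilon> t" and "t * soft_recip \<epsilon> t \<le> 1 / 2"
proof -
  note d = soft_recip_denominator[OF assms(1), of t]
  note b = soft_recip_bounds[OF assms(1), of t]
  have q: "0 \<le> t / sqrt (\<epsilon>\<^sup>2 + t\<^sup>2)" using assms by simp
  show "soft_recip' \<epsilon> t \<le> - (soft_recip \<epsilon> t)\<^sup>2"
    unfolding soft_recip'_def using mult_right_mono[of 1 "1 + t / sqrt (\<epsilon>\<^sup>2 + t\<^sup>2)" "(soft_recip \<epsilon> t)\<^sup>2"] q
    by (simp only: mult_minus_left mult_1_left neg_le_iff_le) simp
  show "\<bar>soft_recip' \<epsilon> t\<bar> \<le> 2 * (soft_recip \<epsilon> t)\<^sup>2"
    unfolding soft_recip'_def abs_mult using q d by (intro mult_mono) auto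
  show "0 \<le> t * soft_recip \<epsilon> t" using b assms by simp
  have "t \<le> sqrt (\<epsilon>\<^sup>2 + t\<^sup>2)" using assms by (intro real_le_rsqrt) auto
  then have "2 * t \<le> \<epsilon> + t + sqrt (\<epsilon>\<^sup>2 + t\<^sup>2)" using assms by linarith
  then show "t * soft_recip \<epsilon> t \<le> 1 / 2"
    using assms d(1) unfolding soft_recip_def inverse_eq_divide times_divide_eq_right
    by (subst pos_divide_le_eq, linarith, simp)
qed

lemma soft_recip_deriv:
  assumes "\<epsilon> > 0"
  shows "(soft_recip \<epsilon> has_real_derivative soft_recip' \<epsilon> t) (at t)"
proof -
  note d = soft_recip_denominator[OF assms, of t]
  have "((\<lambda>t. sqrt (\<epsilon>\<^sup>2 + t\<^sup>2)) has_real_derivative t / sqrt (\<epsilon>\<^sup>2 + t\<^sup>2)) (at t)"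
    using d(3) by (auto intro!: derivative_eq_intros simp: inverse_eq_divide)
  from DERIV_add[OF DERIV_add[OF DERIV_const DERIV_ident] this, of \<epsilon>]
  have "((\<lambda>t. \<epsilon> + t + sqrt (\<epsilon>\<^sup>2 + t\<^sup>2)) has_real_derivative 1 + t / sqrt (\<epsilon>\<^sup>2 + t\<^sup>2)) (at t)"
    by simp
  moreover have "\<epsilon> + t + sqrt (\<epsilon>\<^sup>2 + t\<^sup>2) \<noteq> 0"
    using d(1) assms by linarith
  ultimately show ?thesis
    unfolding soft_recip_def[abs_def] soft_recip'_def
    by (rule DERIV_cong[OF DERIV_inverse_fun])
      (simp only: numeral_2_eq_2 power_inverse mult_minus_left)
qed

lemma Ck_soft_recip:
  assumes "\<epsilon> > 0" and "Ck k g"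
  shows "Ck k (\<lambda>x. soft_recip \<epsilon> (g x))"
proof -
  have "\<epsilon> + t + sqrt (\<epsilon>\<^sup>2 + t * t) > 0" "\<epsilon>\<^sup>2 + t * t > 0" for t
    using soft_recip_denominator[OF assms(1), of t] assms(1)
    by (auto simp: power2_eq_square add_pos_nonneg)
  then show ?thesis
    unfolding soft_recip_def power2_eq_square[of "g _"]
    by (intro Ck_inverse Ck_add Ck_sqrt Ck_mult Ck_const assms(2))
qed

lemma continuous_soft_recip:
  assumes "\<epsilon> > 0"
  shows "continuous_on UNIV (soft_recip \<epsilon>)" "continuous_on UNIV (soft_recip' \<epsilon>)"
proof -
  show *: "continuous_on UNIV (soft_recip \<epsilon>)"
    using soft_recip_deriv[OF assms] DERIV_isCont by (metis continuous_at_imp_continuous_on)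
  show "continuous_on UNIV (soft_recip' \<epsilon>)"
    unfolding soft_recip'_def[abs_def] using soft_recip_denominator[OF assms]
    by (intro continuous_intros *) (auto simp: less_imp_neq[symmetric])
qed

lemma soft_recip_limit:
  assumes "t > 0"
  shows "(\<lambda>k. t * soft_recip (1 / Suc k) t) \<longlonglongrightarrow> 1 / 2"
proof -
  have "(\<lambda>k. 1 / Suc k) \<longlonglongrightarrow> (0::real)"
    using LIMSEQ_inverse_real_of_nat by (simp add: divide_inverse)
  then have "(\<lambda>k. t * inverse (1 / Suc k + t + sqrt ((1 / Suc k)\<^sup>2 + t\<^sup>2))) \<longlonglongrightarrow>
      t * inverse (0 + t + sqrt (0\<^sup>2 + t\<^sup>2))"
    by (intro tendsto_intros) (use assms in auto)
  then show ?thesis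
    using assms by (simp add: soft_recip_def)
qed

section \<open>Square-integrable functions\<close>

lemma borel_measurable_lebesgue_onI:
  assumes "f \<in> borel_measurable borel"
  shows "f \<in> borel_measurable (lebesgue_on S)"
  using assms by (intro measurable_restrict_space1 measurable_completion) simp

lemma continuous_measurable_lebesgue_on:
  "continuous_on UNIV f \<Longrightarrow> f \<in> borel_measurable (lebesgue_on S)"
  by (intro borel_measurable_lebesgue_onI borel_measurable_continuous_onI)

text \<open>The second form is the one into which the simplifier brings the exponent.\<close>

lemma in_Lq_2_iff:
  "in_Lq 2 S h \<longleftrightarrow> h \<in> borel_measurable (lebesgue_on S) \<and> integrable (lebesgue_on S) (\<lambda>x. (norm (h x))\<^sup>2)"
  "in_Lq (ereal 2) S h \<longleftrightarrow> h \<in> borel_measurable (lebesgue_on S) \<and> integrable (lebesgue_on S) (\<lambda>x. (norm (h x))\<^sup>2)"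
proof -
  show *: "in_Lq (ereal 2) S h \<longleftrightarrow>
      h \<in> borel_measurable (lebesgue_on S) \<and> integrable (lebesgue_on S) (\<lambda>x. (norm (h x))\<^sup>2)"
    by (simp add: in_Lq_def)
  then show "in_Lq 2 S h \<longleftrightarrow>
      h \<in> borel_measurable (lebesgue_on S) \<and> integrable (lebesgue_on S) (\<lambda>x. (norm (h x))\<^sup>2)"
    by simp
qed

lemma Lq_norm_2:
  "Lq_norm 2 S h = sqrt (LINT x|lebesgue_on S. (norm (h x))\<^sup>2)"
  "Lq_norm (ereal 2) S h = sqrt (LINT x|lebesgue_on S. (norm (h x))\<^sup>2)"
proof -
  show *: "Lq_norm (ereal 2) S h = sqrt (LINT x|lebesgue_on S. (norm (h x))\<^sup>2)"
    by (simp add: Lq_norm_def powr_half_sqrt)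
  then show "Lq_norm 2 S h = sqrt (LINT x|lebesgue_on S. (norm (h x))\<^sup>2)"
    by simp
qed

lemma in_Lq_2_measurable: "in_Lq 2 S h \<Longrightarrow> h \<in> borel_measurable (lebesgue_on S)"
  by (simp add: in_Lq_2_iff)

lemma in_Lq_2_bounded:
  assumes "S \<in> lmeasurable" and "h \<in> borel_measurable (lebesgue_on S)" and "AE x in lebesgue_on S. norm (h x) \<le> K"
  shows "in_Lq 2 S h"
proof -
  interpret finite_measure "lebesgue_on S"
    using assms(1) by (rule finite_measure_lebesgue_on)
  have "integrable (lebesgue_on S) (\<lambda>x. (norm (h x))\<^sup>2)"
  proof (rule integrable_const_bound)
    show "AE x in lebesgue_on S. norm ((norm (h x))\<^sup>2) \<le> K\<^sup>2"
      using assms(3) by eventually_elim (auto intro: power_mono)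
  qed (use assms(2) in measurable)
  then show ?thesis using assms by (simp add: in_Lq_2_iff)
qed

lemma integrable_inner_L2:
  fixes f g :: "'a::euclidean_space \<Rightarrow> 'b::euclidean_space"
  assumes "in_Lq 2 S f" and "in_Lq 2 S g"
  shows "integrable (lebesgue_on S) (\<lambda>x. f x \<bullet> g x)"
proof (rule Bochner_Integration.integrable_bound)
  show "integrable (lebesgue_on S) (\<lambda>x. (norm (f x))\<^sup>2 + (norm (g x))\<^sup>2)"
    using assms by (simp add: in_Lq_2_iff)
  have "\<bar>a \<bullet> b\<bar> \<le> (norm a)\<^sup>2 + (norm b)\<^sup>2" for a b :: 'b
    using Cauchy_Schwarz_ineq2[of a b] sum_squares_bound[of "norm a" "norm b"]
      mult_nonneg_nonneg[OF norm_ge_zero[of a] norm_ge_zero[of b]]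
    unfolding mult.assoc by linarith
  then show "AE x in lebesgue_on S. norm (f x \<bullet> g x) \<le> norm ((norm (f x))\<^sup>2 + (norm (g x))\<^sup>2)"
    by simp
  show "(\<lambda>x. f x \<bullet> g x) \<in> borel_measurable (lebesgue_on S)"
    using in_Lq_2_measurable[OF assms(1)] in_Lq_2_measurable[OF assms(2)] by measurable
qed

lemma integrable_mult_L2:
  fixes f g :: "'a::euclidean_space \<Rightarrow> real"
  assumes "in_Lq 2 S f" and "in_Lq 2 S g"
  shows "integrable (lebesgue_on S) (\<lambda>x. f x * g x)"
  using integrable_inner_L2[OF assms] by simp

lemma integrable_bounded_mult:
  fixes f :: "'a::euclidean_space \<Rightarrow> real"
  assumes "integrable (lebesgue_on S) f" and "g \<in> borel_measurable (lebesgue_on S)"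
    and "\<And>x. x \<in> S \<Longrightarrow> \<bar>g x\<bar> \<le> K"
  shows "integrable (lebesgue_on S) (\<lambda>x. g x * f x)"
proof (rule Bochner_Integration.integrable_bound[of _ "\<lambda>x. K * f x"])
  show "AE x in lebesgue_on S. norm (g x * f x) \<le> norm (K * f x)"
    using assms(3) by (intro AE_I2) (force simp: abs_mult intro: mult_right_mono)
qed (use assms in auto)

lemma in_Lq_2_bounded_scale:
  assumes "in_Lq 2 S f"
    and "\<And>x. x \<in> S \<Longrightarrow> norm (h x) \<le> K * norm (f x)" and "h \<in> borel_measurable (lebesgue_on S)"
  shows "in_Lq 2 S h"
proof -
  have "integrable (lebesgue_on S) (\<lambda>x. (norm (h x))\<^sup>2)"
  proof (rule Bochner_Integration.integrable_bound[of _ "\<lambda>x. K\<^sup>2 * (norm (f x))\<^sup>2"])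
    show "AE x in lebesgue_on S. norm ((norm (h x))\<^sup>2) \<le> norm (K\<^sup>2 * (norm (f x))\<^sup>2)"
      using power_mono[OF assms(2), of _ 2] by (intro AE_I2) (simp add: power_mult_distrib)
  qed (use assms in \<open>auto simp: in_Lq_2_iff\<close>)
  then show ?thesis using assms by (simp add: in_Lq_2_iff)
qed

lemma in_Lq_2_add:
  assumes "in_Lq 2 S f" and "in_Lq 2 S g"
  shows "in_Lq 2 S (\<lambda>x. f x + g x)"
proof -
  have [measurable]: "f \<in> borel_measurable (lebesgue_on S)" "g \<in> borel_measurable (lebesgue_on S)"
    using assms by (auto simp: in_Lq_2_iff)
  have "integrable (lebesgue_on S) (\<lambda>x. (norm (f x + g x))\<^sup>2)"
  proof (rule Bochner_Integration.integrable_bound)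
    show "integrable (lebesgue_on S) (\<lambda>x. 2 * (norm (f x))\<^sup>2 + 2 * (norm (g x))\<^sup>2)"
      using assms by (simp add: in_Lq_2_iff)
    have "(norm (f x + g x))\<^sup>2 \<le> 2 * (norm (f x))\<^sup>2 + 2 * (norm (g x))\<^sup>2" for x
      using power_mono[OF norm_triangle_ineq[of "f x" "g x"], of 2] sum_squares_bound[of "norm (f x)" "norm (g x)"]
      by (simp add: power2_sum)
    then show "AE x in lebesgue_on S. norm ((norm (f x + g x))\<^sup>2) \<le> norm (2 * (norm (f x))\<^sup>2 + 2 * (norm (g x))\<^sup>2)"
      by simp
  qed measurable
  then show ?thesis by (simp add: in_Lq_2_iff)
qed

lemma in_Lq_2_diff:
  assumes "in_Lq 2 S f" and "in_Lq 2 S g"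
  shows "in_Lq 2 S (\<lambda>x. f x - g x)"
proof -
  have "in_Lq 2 S (\<lambda>x. - g x)" using assms(2) by (simp add: in_Lq_2_iff)
  from in_Lq_2_add[OF assms(1) this] show ?thesis by simp
qed

lemma in_Lq_2_component:
  fixes f :: "'a::euclidean_space \<Rightarrow> real^'n"
  assumes "in_Lq 2 S f"
  shows "in_Lq 2 S (\<lambda>x. f x $ i)"
proof (rule in_Lq_2_bounded_scale[OF assms, where K = 1])
  show "(\<lambda>x. f x $ i) \<in> borel_measurable (lebesgue_on S)"
    using borel_measurable_inner[OF in_Lq_2_measurable[OF assms] borel_measurable_const[of "axis i 1"]]
    by (simp add: inner_axis)
qed (use component_le_norm_cart in auto)

lemma norm_matrix_vector_mult_le:
  fixes A :: "real^'n^'m"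
  shows "norm (A *v x) \<le> norm A * norm x"
proof -
  have "norm (A *v x) = L2_set (\<lambda>i. norm (A $ i \<bullet> x)) UNIV"
    by (simp add: norm_vec_def matrix_vector_mult_def inner_vec_def)
  also have "\<dots> \<le> L2_set (\<lambda>i. norm (A $ i) * norm x) UNIV"
    by (intro L2_set_mono) (auto simp: Cauchy_Schwarz_ineq2)
  also have "\<dots> = norm A * norm x"
    unfolding norm_vec_def[of A] by (rule L2_set_left_distrib[symmetric]) simp
  finally show ?thesis .
qed

lemma borel_measurable_matrix_vector_mult:
  fixes A :: "'a \<Rightarrow> real^'n^'m"
  assumes "A \<in> borel_measurable M" and "D \<in> borel_measurable M"
  shows "(\<lambda>x. A x *v D x) \<in> borel_measurable M"
proof (rule borel_measurable_continuous_Pair[OF assms])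
  show "continuous_on UNIV (\<lambda>z. (fst z :: real^'n^'m) *v snd z)"
    unfolding matrix_vector_mult_def by (intro continuous_intros)
qed

lemma test_function_measurable:
  assumes "test_function \<Omega> \<phi>"
  shows "\<phi> \<in> borel_measurable (lebesgue_on S)" and "gradient \<phi> \<in> borel_measurable (lebesgue_on S)"
proof -
  show "\<phi> \<in> borel_measurable (lebesgue_on S)"
    using assms Ck_continuous by (auto simp: test_function_def intro!: continuous_measurable_lebesgue_on)
  have "continuous_on UNIV (\<lambda>x. gradient \<phi> x $ i)" for i
    using test_function_gradient[OF assms, of i] Ck_continuous by (auto simp: test_function_def)
  then have "continuous_on UNIV (\<lambda>x. \<chi> i. gradient \<phi> x $ i)"
    by (rule continuous_on_vec_lambda)
  then show "gradient \<phi> \<in> borel_measurable (lebesgue_on S)"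
    by (intro continuous_measurable_lebesgue_on) simp
qed

lemma in_Lq_2_test_function:
  assumes "S \<in> lmeasurable" and "test_function \<Omega> \<phi>"
  shows "in_Lq 2 S \<phi>" and "in_Lq 2 S (gradient \<phi>)"
proof -
  obtain B C where "\<And>x. \<bar>\<phi> x\<bar> \<le> B" "\<And>x. norm (gradient \<phi> x) \<le> C"
    using test_function_bounded[OF assms(2)] test_function_gradient_bounded[OF assms(2)] by metis
  then show "in_Lq 2 S \<phi>" "in_Lq 2 S (gradient \<phi>)"
    using in_Lq_2_bounded[OF assms(1) test_function_measurable(1)[OF assms(2)], of B]
      in_Lq_2_bounded[OF assms(1) test_function_measurable(2)[OF assms(2)], of C] by auto
qed

text \<open>Young's inequality with a weight \<open>s k\<close> that tends to 0, but so slowly that \<open>(s k)\<^sup>2\<close> still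
  bounds the squared norm of \<open>V k\<close>, makes both resulting terms \<open>O(s k)\<close>.\<close>

lemma tendsto_integral_inner_L2_zero:
  fixes W :: "'a::euclidean_space \<Rightarrow> 'b::euclidean_space"
  assumes W: "in_Lq 2 S W" and V: "\<And>k. in_Lq 2 S (V k)"
    and lim: "(\<lambda>k. LINT x|lebesgue_on S. (norm (V k x))\<^sup>2) \<longlonglongrightarrow> 0"
    and g: "\<And>k. g k \<in> borel_measurable (lebesgue_on S)" "\<And>k x. x \<in> S \<Longrightarrow> \<bar>g k x\<bar> \<le> K"
  shows "(\<lambda>k. LINT x|lebesgue_on S. g k x * (W x \<bullet> V k x)) \<longlonglongrightarrow> 0"
proof -
  let ?I = "\<lambda>f. LINT x|lebesgue_on S. f x"
  let ?v = "\<lambda>k. ?I (\<lambda>x. (norm (V k x))\<^sup>2)"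
  \<comment> \<open>The summand \<open>inverse (Suc k)\<close> keeps the weight positive even where \<open>V k\<close> vanishes.\<close>
  define s where "s k = sqrt (?v k + inverse (real (Suc k)))" for k
  have v0: "?v k \<ge> 0" for k by simp
  have s: "s k > 0" "(s k)\<^sup>2 = ?v k + inverse (real (Suc k))" for k
    using v0[of k] by (auto simp: s_def add_nonneg_pos simp del: of_nat_Suc)
  have "s \<longlonglongrightarrow> sqrt (0 + 0)"
    unfolding s_def[abs_def] by (intro tendsto_intros lim LIMSEQ_inverse_real_of_nat)
  then have s0: "s \<longlonglongrightarrow> 0" by simp
  define C where "C = \<bar>K\<bar> * (?I (\<lambda>x. (norm (W x))\<^sup>2) + 1)"
  have "\<bar>?I (\<lambda>x. g k x * (W x \<bullet> V k x))\<bar> \<le> C * s k" for k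
  proof -
    have "\<bar>?I (\<lambda>x. g k x * (W x \<bullet> V k x))\<bar> \<le> ?I (\<lambda>x. \<bar>g k x * (W x \<bullet> V k x)\<bar>)"
      by (rule integral_abs_bound)
    also have "\<dots> \<le> ?I (\<lambda>x. \<bar>K\<bar> * (s k * (norm (W x))\<^sup>2 + inverse (s k) * (norm (V k x))\<^sup>2))"
    proof (rule integral_mono)
      show "integrable (lebesgue_on S) (\<lambda>x. \<bar>g k x * (W x \<bullet> V k x)\<bar>)"
        by (intro integrable_abs integrable_bounded_mult[OF integrable_inner_L2[OF W V], where K = K] g)
      show "integrable (lebesgue_on S) (\<lambda>x. \<bar>K\<bar> * (s k * (norm (W x))\<^sup>2 + inverse (s k) * (norm (V k x))\<^sup>2))"
        using W V[of k] by (simp add: in_Lq_2_iff)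
      fix x assume x: "x \<in> space (lebesgue_on S)"
      have "\<bar>W x \<bullet> V k x\<bar> \<le> norm (W x) * norm (V k x)"
        by (rule Cauchy_Schwarz_ineq2)
      also have "\<dots> \<le> s k * (norm (W x))\<^sup>2 + inverse (s k) * (norm (V k x))\<^sup>2"
      proof -
        have "2 * (s k * norm (W x)) * norm (V k x) \<le> (s k * norm (W x))\<^sup>2 + (norm (V k x))\<^sup>2"
          by (rule sum_squares_bound)
        then have "s k * norm (W x) * norm (V k x) \<le> (s k * norm (W x))\<^sup>2 + (norm (V k x))\<^sup>2"
          using s(1)[of k] by (intro order_trans[OF _ \<open>2 * (s k * norm (W x)) * norm (V k x) \<le> _\<close>]) simp
        then show ?thesis using s(1)[of k] by (simp add: field_simps power2_eq_square)
      qed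
      finally show "\<bar>g k x * (W x \<bullet> V k x)\<bar> \<le> \<bar>K\<bar> * (s k * (norm (W x))\<^sup>2 + inverse (s k) * (norm (V k x))\<^sup>2)"
        unfolding abs_mult using g(2)[of x k] x by (intro mult_mono) auto
    qed
    also have "\<dots> = \<bar>K\<bar> * (s k * ?I (\<lambda>x. (norm (W x))\<^sup>2) + inverse (s k) * ?v k)"
      using W V[of k] by (simp add: in_Lq_2_iff)
    also have "\<dots> \<le> C * s k"
    proof -
      have "?v k \<le> s k * s k" using s(2)[of k] by (simp add: power2_eq_square)
      then have "inverse (s k) * ?v k \<le> s k" using s(1)[of k] by (simp add: field_simps)
      then have "s k * ?I (\<lambda>x. (norm (W x))\<^sup>2) + inverse (s k) * ?v k \<le> s k * (?I (\<lambda>x. (norm (W x))\<^sup>2) + 1)"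
        by (simp add: algebra_simps)
      from mult_left_mono[OF this, of "\<bar>K\<bar>"] show ?thesis
        unfolding C_def by (simp only: abs_ge_zero mult.assoc mult.commute[of "s k"])
    qed
    finally show ?thesis .
  qed
  then have "\<forall>k. norm (?I (\<lambda>x. g k x * (W x \<bullet> V k x))) \<le> C * s k" by simp
  then show ?thesis
    using tendsto_mult_right_zero[OF s0, of C] by (rule Lim_null_comparison[OF always_eventually])
qed

section \<open>Weak gradients and nonlinear test functions\<close>

text \<open>A constant antisymmetric matrix \<open>S\<close> contributes nothing to the bilinear form: moving both derivatives
  to the smooth test function leaves the contraction of \<open>S\<close> with a symmetric Hessian. This is what
  makes an estimate possible although the ellipticity bounds say nothing about the antisymmetric
  part of \<open>A\<close>.\<close>

lemma integral_antisymmetric_zero: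
  fixes S :: "real^'n^'n"
  assumes \<Omega>: "\<Omega> \<in> lmeasurable" and Du: "in_Lq 2 \<Omega> Du" and w: "weak_gradient \<Omega> u Du"
    and S: "\<And>i j. S $ i $ j = - S $ j $ i" and \<psi>: "test_function \<Omega> \<psi>"
  shows "(LINT x|lebesgue_on \<Omega>. (S *v Du x) \<bullet> gradient \<psi> x) = 0"
proof -
  define T where "T i j = (LINT x|lebesgue_on \<Omega>. Du x $ j * gradient \<psi> x $ i)" for i j
  have sym: "T i j = T j i" for i j
  proof -
    have "T i j = - (LINT x|lebesgue_on \<Omega>. u x * gradient (\<lambda>x. gradient \<psi> x $ i) x $ j)" for i j
      using w test_function_gradient[OF \<psi>, of i] by (simp add: weak_gradient_def T_def)
    moreover have "Ck 2 \<psi>" using \<psi> by (simp add: test_function_def)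
    ultimately show ?thesis using gradient_gradient_commute[of \<psi>] by simp
  qed
  have int: "integrable (lebesgue_on \<Omega>) (\<lambda>x. Du x $ j * gradient \<psi> x $ i)" for i j
    by (intro integrable_mult_L2 in_Lq_2_component Du in_Lq_2_test_function[OF \<Omega> \<psi>])
  have "(LINT x|lebesgue_on \<Omega>. (S *v Du x) \<bullet> gradient \<psi> x)
      = (LINT x|lebesgue_on \<Omega>. (\<Sum>i\<in>UNIV. \<Sum>j\<in>UNIV. S $ i $ j * (Du x $ j * gradient \<psi> x $ i)))"
    by (simp add: inner_vec_def matrix_vector_mult_def sum_distrib_right mult.assoc)
  also have "\<dots> = (\<Sum>i\<in>UNIV. \<Sum>j\<in>UNIV. S $ i $ j * T i j)"
    using int by (simp add: T_def)
  also have "\<dots> = - (\<Sum>i\<in>UNIV. \<Sum>j\<in>UNIV. S $ j $ i * T j i)"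
    unfolding sum_negf[symmetric] by (intro sum.cong refl) (metis S sym mult_minus_left)
  also have "(\<Sum>i\<in>UNIV. \<Sum>j\<in>UNIV. S $ j $ i * T j i) = (\<Sum>i\<in>UNIV. \<Sum>j\<in>UNIV. S $ i $ j * T i j)"
    by (rule sum.swap)
  finally have "(LINT x|lebesgue_on \<Omega>. (S *v Du x) \<bullet> gradient \<psi> x) = - (\<Sum>i\<in>UNIV. \<Sum>j\<in>UNIV. S $ i $ j * T i j)" .
  moreover have "(LINT x|lebesgue_on \<Omega>. (S *v Du x) \<bullet> gradient \<psi> x) = (\<Sum>i\<in>UNIV. \<Sum>j\<in>UNIV. S $ i $ j * T i j)"
    using int by (simp add: T_def inner_vec_def matrix_vector_mult_def sum_distrib_right mult.assoc)
  ultimately show ?thesis by simp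
qed

lemma neg_L_form_diff_antisymmetric:
  fixes S :: "real^'n^'n"
  assumes \<Omega>: "\<Omega> \<in> lmeasurable" and Du: "in_Lq 2 \<Omega> Du" and w: "weak_gradient \<Omega> u Du"
    and S: "\<And>i j. S $ i $ j = - S $ j $ i" and \<psi>: "test_function \<Omega> \<psi>"
  shows "neg_L_form \<Omega> (\<lambda>x. A x - S) b1 b2 c u Du \<psi> = neg_L_form \<Omega> A b1 b2 c u Du \<psi>"
proof -
  let ?M = "lebesgue_on \<Omega>"
  let ?f = "\<lambda>x. ((A x - S) *v Du x + u x *\<^sub>R b1 x) \<bullet> gradient \<psi> x - (b2 x \<bullet> Du x) * \<psi> x - c x * u x * \<psi> x"
  let ?g = "\<lambda>x. (S *v Du x) \<bullet> gradient \<psi> x"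
  have g: "integrable ?M ?g"
  proof (rule integrable_inner_L2[OF in_Lq_2_bounded_scale[OF Du norm_matrix_vector_mult_le] in_Lq_2_test_function(2)[OF \<Omega> \<psi>]])
    show "(\<lambda>x. S *v Du x) \<in> borel_measurable ?M"
      by (rule borel_measurable_matrix_vector_mult[OF borel_measurable_const in_Lq_2_measurable[OF Du]])
  qed
  have "neg_L_form \<Omega> A b1 b2 c u Du \<psi> = (LINT x|?M. ?f x + ?g x)"
    unfolding neg_L_form_def
    by (intro Bochner_Integration.integral_cong)
      (auto simp: matrix_vector_mult_diff_rdistrib inner_left_distrib inner_diff_left)
  also have "\<dots> = (LINT x|?M. ?f x)"
  proof (cases "integrable ?M ?f")
    case True
    then show ?thesis
      using g integral_antisymmetric_zero[OF \<Omega> Du w S \<psi>] by simp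
  next
    case False
    \<comment> \<open>Then neither function is integrable and both integrals are 0 by convention.\<close>
    have "\<not> integrable ?M (\<lambda>x. ?f x + ?g x)"
    proof
      assume "integrable ?M (\<lambda>x. ?f x + ?g x)"
      from Bochner_Integration.integrable_diff[OF this g] False show False by simp
    qed
    from not_integrable_integral_eq[OF this] not_integrable_integral_eq[OF False] show ?thesis
      by (rule trans[OF _ sym])
  qed
  finally show ?thesis by (simp add: neg_L_form_def)
qed

lemma H10_approximation:
  assumes \<Omega>: "\<Omega> \<in> lmeasurable" and H: "H10 \<Omega> u Du"
  obtains v where "\<And>k::nat. test_function \<Omega> (v k)"
    and "AE x in lebesgue_on \<Omega>. (\<lambda>k. v k x) \<longlonglongrightarrow> u x"
    and "(\<lambda>k. LINT x|lebesgue_on \<Omega>. (norm (gradient (v k) x - Du x))\<^sup>2) \<longlonglongrightarrow> 0"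
proof -
  obtain \<phi> where \<phi>: "\<And>k::nat. test_function \<Omega> (\<phi> k)"
    and l: "(\<lambda>k. Lq_norm 2 \<Omega> (\<lambda>x. \<phi> k x - u x)) \<longlonglongrightarrow> 0"
      "(\<lambda>k. Lq_norm 2 \<Omega> (\<lambda>x. gradient (\<phi> k) x - Du x)) \<longlonglongrightarrow> 0"
    and L2: "in_Lq 2 \<Omega> u" "in_Lq 2 \<Omega> Du"
    using H unfolding H10_def by blast
  have sq: "(\<lambda>k. LINT x|lebesgue_on \<Omega>. (norm (f k x))\<^sup>2) \<longlonglongrightarrow> 0"
    if "(\<lambda>k. Lq_norm 2 \<Omega> (f k)) \<longlonglongrightarrow> 0" for f :: "nat \<Rightarrow> real^'a \<Rightarrow> 'b::euclidean_space"
    using tendsto_power[OF that, of 2] by (simp add: Lq_norm_2)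
  have "integrable (lebesgue_on \<Omega>) (\<lambda>x. (norm (\<phi> k x - u x))\<^sup>2)" for k
    using in_Lq_2_diff[OF in_Lq_2_test_function(1)[OF \<Omega> \<phi>] L2(1), of k] by (simp add: in_Lq_2_iff)
  moreover have "(\<lambda>k. LINT x|lebesgue_on \<Omega>. norm ((norm (\<phi> k x - u x))\<^sup>2)) \<longlonglongrightarrow> 0"
    using sq[OF l(1)] by simp
  ultimately obtain r where r: "strict_mono r"
    and ae: "AE x in lebesgue_on \<Omega>. (\<lambda>k. (norm (\<phi> (r k) x - u x))\<^sup>2) \<longlonglongrightarrow> 0"
    using tendsto_L1_AE_subseq[of "lebesgue_on \<Omega>" "\<lambda>k x. (norm (\<phi> k x - u x))\<^sup>2"] by blast
  show ?thesis
  proof (rule that[of "\<lambda>k. \<phi> (r k)"])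
    show "AE x in lebesgue_on \<Omega>. (\<lambda>k. \<phi> (r k) x) \<longlonglongrightarrow> u x"
      using ae
    proof eventually_elim
      case (elim x)
      from tendsto_real_sqrt[OF elim] have "(\<lambda>k. \<phi> (r k) x - u x) \<longlonglongrightarrow> 0"
        by (simp add: tendsto_rabs_zero_iff)
      then show ?case by (simp add: LIM_zero_iff)
    qed
    show "(\<lambda>k. LINT x|lebesgue_on \<Omega>. (norm (gradient (\<phi> (r k)) x - Du x))\<^sup>2) \<longlonglongrightarrow> 0"
      using LIMSEQ_subseq_LIMSEQ[OF sq[OF l(2)] r] by (simp add: o_def)
  qed (rule \<phi>)
qed

text \<open>The equation \<open>div W + h = 0\<close> is tested with \<open>\<eta> G(u)\<close>, where \<open>G\<close> is the regularised reciprocal. If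
  \<open>v k\<close> are test functions that converge to \<open>u\<close> in \<open>H\<^sup>1\<close>, then \<open>\<eta> G(v k)\<close> are test functions. Since
  \<open>G\<close> and \<open>G'\<close> are bounded and continuous, dominated convergence along an almost everywhere
  convergent subsequence applies to everything except the term with the gradient of \<open>v k - u\<close>, which
  tends to 0 in \<open>L\<^sup>2\<close>.\<close>

lemma weak_form_soft_recip:
  fixes u :: "real^'n \<Rightarrow> real"
  assumes \<Omega>: "\<Omega> \<in> lmeasurable" and H: "H10 \<Omega> u Du"
    and W: "in_Lq 2 \<Omega> W" and h: "integrable (lebesgue_on \<Omega>) h"
    and weak: "\<And>\<psi>. test_function \<Omega> \<psi> \<Longrightarrow>
      (LINT x|lebesgue_on \<Omega>. W x \<bullet> gradient \<psi> x) = (LINT x|lebesgue_on \<Omega>. h x * \<psi> x)"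
    and \<eta>: "test_function \<Omega> \<eta>" and \<epsilon>: "\<epsilon> > 0"
  shows "integrable (lebesgue_on \<Omega>) (\<lambda>x. W x \<bullet> (soft_recip \<epsilon> (u x) *\<^sub>R gradient \<eta> x + (\<eta> x * soft_recip' \<epsilon> (u x)) *\<^sub>R Du x))"
    and "integrable (lebesgue_on \<Omega>) (\<lambda>x. h x * (\<eta> x * soft_recip \<epsilon> (u x)))"
    and "(LINT x|lebesgue_on \<Omega>. W x \<bullet> (soft_recip \<epsilon> (u x) *\<^sub>R gradient \<eta> x + (\<eta> x * soft_recip' \<epsilon> (u x)) *\<^sub>R Du x))
      = (LINT x|lebesgue_on \<Omega>. h x * (\<eta> x * soft_recip \<epsilon> (u x)))"
proof -
  let ?M = "lebesgue_on \<Omega>" and ?G = "soft_recip \<epsilon>" and ?G' = "soft_recip' \<epsilon>"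
  obtain v where v: "\<And>k::nat. test_function \<Omega> (v k)"
    and ae: "AE x in ?M. (\<lambda>k. v k x) \<longlonglongrightarrow> u x"
    and grad: "(\<lambda>k. LINT x|?M. (norm (gradient (v k) x - Du x))\<^sup>2) \<longlonglongrightarrow> 0"
    using H10_approximation[OF \<Omega> H] by blast
  have u: "in_Lq 2 \<Omega> u" and Du: "in_Lq 2 \<Omega> Du" using H by (auto simp: H10_def)
  obtain B where B: "B > 0" "\<And>x. \<bar>\<eta> x\<bar> \<le> B" using test_function_bounded[OF \<eta>] by metis
  note bd = soft_recip_bounds[OF \<epsilon>]
  have cont: "isCont ?G t" "isCont ?G' t" for t
    using continuous_soft_recip[OF \<epsilon>] by (auto simp: continuous_on_eq_continuous_at)
  have [measurable]: "?G \<in> borel_measurable borel" "?G' \<in> borel_measurable borel"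
    using continuous_soft_recip[OF \<epsilon>] by (auto intro: borel_measurable_continuous_onI)
  have [measurable]: "u \<in> borel_measurable ?M" "Du \<in> borel_measurable ?M" "W \<in> borel_measurable ?M"
    "h \<in> borel_measurable ?M" "\<eta> \<in> borel_measurable ?M" "gradient \<eta> \<in> borel_measurable ?M"
    "v k \<in> borel_measurable ?M" "gradient (v k) \<in> borel_measurable ?M" for k
    using u Du W h test_function_measurable[OF \<eta>] test_function_measurable[OF v]
    by (auto simp: in_Lq_2_iff)
  have iWg: "integrable ?M (\<lambda>x. W x \<bullet> gradient \<eta> x)"
    by (rule integrable_inner_L2[OF W in_Lq_2_test_function(2)[OF \<Omega> \<eta>]])
  have iWD: "integrable ?M (\<lambda>x. W x \<bullet> Du x)"
    by (rule integrable_inner_L2[OF W Du])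
  have \<eta>G': "\<bar>\<eta> x * ?G' t\<bar> \<le> B * (2 / \<epsilon>\<^sup>2)" and \<eta>G: "\<bar>\<eta> x * ?G t\<bar> \<le> B * (1 / \<epsilon>)" for x t
    unfolding abs_mult using B bd(3)[of t] bd(1,2)[of t] by (auto intro!: mult_mono simp del: times_divide_eq_right)
  have G: "\<bar>?G t\<bar> \<le> 1 / \<epsilon>" for t using bd(1,2)[of t] by simp
  define F where "F w x = ?G (w x) * (W x \<bullet> gradient \<eta> x) + (\<eta> x * ?G' (w x)) * (W x \<bullet> Du x)" for w x
  have F_eq: "W x \<bullet> (?G (u x) *\<^sub>R gradient \<eta> x + (\<eta> x * ?G' (u x)) *\<^sub>R Du x) = F u x" for x
    by (simp add: F_def inner_right_distrib)
  have iF: "integrable ?M (F w)" if [measurable]: "w \<in> borel_measurable ?M" for w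
    unfolding F_def[abs_def]
    by (intro Bochner_Integration.integrable_add integrable_bounded_mult[OF iWg] integrable_bounded_mult[OF iWD])
      (use G \<eta>G' in \<open>measurable; blast\<close>)+
  have ih: "integrable ?M (\<lambda>x. h x * (\<eta> x * ?G (w x)))" if [measurable]: "w \<in> borel_measurable ?M" for w
    unfolding mult.commute[of "h _"]
    by (rule integrable_bounded_mult[OF h]) (use \<eta>G in \<open>measurable; blast\<close>)+
  show "integrable ?M (\<lambda>x. W x \<bullet> (?G (u x) *\<^sub>R gradient \<eta> x + (\<eta> x * ?G' (u x)) *\<^sub>R Du x))"
    unfolding F_eq by (rule iF) measurable
  show "integrable ?M (\<lambda>x. h x * (\<eta> x * ?G (u x)))" by (rule ih) measurable
  have limF: "(\<lambda>k. LINT x|?M. F (v k) x) \<longlonglongrightarrow> (LINT x|?M. F u x)"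
  proof (rule integral_dominated_convergence[where w = "\<lambda>x. 1 / \<epsilon> * \<bar>W x \<bullet> gradient \<eta> x\<bar> + B * (2 / \<epsilon>\<^sup>2) * \<bar>W x \<bullet> Du x\<bar>"])
    show "integrable ?M (\<lambda>x. 1 / \<epsilon> * \<bar>W x \<bullet> gradient \<eta> x\<bar> + B * (2 / \<epsilon>\<^sup>2) * \<bar>W x \<bullet> Du x\<bar>)"
      using iWg iWD by auto
    show "AE x in ?M. (\<lambda>k. F (v k) x) \<longlonglongrightarrow> F u x"
      using ae unfolding F_def
      by eventually_elim (intro tendsto_intros isCont_tendsto_compose[OF cont(1)] isCont_tendsto_compose[OF cont(2)])
    show "AE x in ?M. norm (F (v k) x) \<le> 1 / \<epsilon> * \<bar>W x \<bullet> gradient \<eta> x\<bar> + B * (2 / \<epsilon>\<^sup>2) * \<bar>W x \<bullet> Du x\<bar>" for k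
    proof (rule AE_I2)
      fix x
      have "norm (F (v k) x) \<le> \<bar>?G (v k x)\<bar> * \<bar>W x \<bullet> gradient \<eta> x\<bar> + \<bar>\<eta> x * ?G' (v k x)\<bar> * \<bar>W x \<bullet> Du x\<bar>"
        unfolding F_def real_norm_def abs_mult[symmetric] by (rule abs_triangle_ineq)
      also have "\<dots> \<le> 1 / \<epsilon> * \<bar>W x \<bullet> gradient \<eta> x\<bar> + B * (2 / \<epsilon>\<^sup>2) * \<bar>W x \<bullet> Du x\<bar>"
        by (intro add_mono mult_right_mono G \<eta>G') auto
      finally show "norm (F (v k) x) \<le> 1 / \<epsilon> * \<bar>W x \<bullet> gradient \<eta> x\<bar> + B * (2 / \<epsilon>\<^sup>2) * \<bar>W x \<bullet> Du x\<bar>" .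
    qed
  qed (simp_all add: F_def[abs_def])
  have limh: "(\<lambda>k. LINT x|?M. h x * (\<eta> x * ?G (v k x))) \<longlonglongrightarrow> (LINT x|?M. h x * (\<eta> x * ?G (u x)))"
  proof (rule integral_dominated_convergence[where w = "\<lambda>x. B * (1 / \<epsilon>) * \<bar>h x\<bar>"])
    show "integrable ?M (\<lambda>x. B * (1 / \<epsilon>) * \<bar>h x\<bar>)" using h by auto
    show "AE x in ?M. (\<lambda>k. h x * (\<eta> x * ?G (v k x))) \<longlonglongrightarrow> h x * (\<eta> x * ?G (u x))"
      using ae by eventually_elim (intro tendsto_intros isCont_tendsto_compose[OF cont(1)])
    show "AE x in ?M. norm (h x * (\<eta> x * ?G (v k x))) \<le> B * (1 / \<epsilon>) * \<bar>h x\<bar>" for k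
      unfolding real_norm_def abs_mult[of "h _"] mult.commute[of "\<bar>h _\<bar>"]
      by (intro AE_I2 mult_right_mono \<eta>G) auto
  qed simp_all
  have V: "in_Lq 2 \<Omega> (\<lambda>x. gradient (v k) x - Du x)" for k
    by (intro in_Lq_2_diff Du in_Lq_2_test_function(2)[OF \<Omega> v])
  have lim0: "(\<lambda>k. LINT x|?M. (\<eta> x * ?G' (v k x)) * (W x \<bullet> (gradient (v k) x - Du x))) \<longlonglongrightarrow> 0"
    by (rule tendsto_integral_inner_L2_zero[OF W V grad _ \<eta>G']) measurable
  have "(LINT x|?M. F (v k) x) + (LINT x|?M. (\<eta> x * ?G' (v k x)) * (W x \<bullet> (gradient (v k) x - Du x)))
      = (LINT x|?M. h x * (\<eta> x * ?G (v k x)))" for k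
  proof -
    let ?\<psi> = "\<lambda>x. \<eta> x * ?G (v k x)"
    have smooth: "Ck m (v k)" for m using v by (simp add: test_function_def)
    have test: "test_function \<Omega> ?\<psi>"
      by (rule test_function_mult[OF \<eta> Ck_soft_recip[OF \<epsilon> smooth]])
    have diff: "v k differentiable (at x)" "(\<lambda>x. ?G (v k x)) differentiable (at x)" "\<eta> differentiable (at x)" for x
      using Ck_differentiable[OF smooth] Ck_differentiable[OF Ck_soft_recip[OF \<epsilon> smooth]]
        Ck_differentiable[of 0 \<eta>] \<eta> unfolding test_function_def by blast+
    have "gradient ?\<psi> x = ?G (v k x) *\<^sub>R gradient \<eta> x + (\<eta> x * ?G' (v k x)) *\<^sub>R gradient (v k) x" for x
      by (simp add: gradient_mult diff gradient_compose[OF soft_recip_deriv[OF \<epsilon>] diff(1)])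
    then have "W x \<bullet> gradient ?\<psi> x = F (v k) x + (\<eta> x * ?G' (v k x)) * (W x \<bullet> (gradient (v k) x - Du x))" for x
      by (simp add: F_def inner_right_distrib inner_diff_right algebra_simps)
    moreover have "integrable ?M (\<lambda>x. (\<eta> x * ?G' (v k x)) * (W x \<bullet> (gradient (v k) x - Du x)))"
      by (rule integrable_bounded_mult[OF integrable_inner_L2[OF W V] _ \<eta>G']) measurable
    ultimately show ?thesis
      using weak[OF test] iF[of "v k"] by simp
  qed
  then have "(\<lambda>k. LINT x|?M. h x * (\<eta> x * ?G (v k x))) \<longlonglongrightarrow> (LINT x|?M. F u x) + 0"
    using tendsto_add[OF limF lim0] by simp
  from LIMSEQ_unique[OF this limh]
  show "(LINT x|?M. W x \<bullet> (?G (u x) *\<^sub>R gradient \<eta> x + (\<eta> x * ?G' (u x)) *\<^sub>R Du x))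
      = (LINT x|?M. h x * (\<eta> x * ?G (u x)))"
    unfolding F_eq by simp
qed

section \<open>Local integrability\<close>

text \<open>A covering estimate without a covering: integrate \<open>\<nu> (ball 0 \<rho> \<inter> ball y 1)\<close> over \<open>y\<close> and
  exchange the order of integration. Only \<open>y\<close> with \<open>norm y < \<rho> + 1\<close> contribute, and
  \<open>\<rho> + 1 \<le> 2 * \<rho>\<close>.\<close>

lemma emeasure_ball_le_unit_balls:
  fixes \<nu> :: "'a::euclidean_space measure" and K :: ennreal
  assumes sets: "sets \<nu> = sets borel" and fin: "finite_measure \<nu>" and \<rho>: "\<rho> \<ge> 1"
    and K: "\<And>y. y \<in> ball 0 (2 * \<rho>) \<Longrightarrow> emeasure \<nu> (ball y 1) \<le> K"
  shows "emeasure \<nu> (ball 0 \<rho>) * emeasure lborel (ball (0::'a) 1) \<le> K * emeasure lborel (ball (0::'a) (2 * \<rho>))"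
proof -
  interpret \<nu>: finite_measure \<nu> by (rule fin)
  interpret P: pair_sigma_finite \<nu> "lborel :: 'a measure" ..
  have [measurable_cong]: "sets \<nu> = sets borel" by (rule sets)
  let ?f = "\<lambda>x y. indicator (ball 0 \<rho>) x * indicator (ball y 1) x :: ennreal"
  have meas: "(\<lambda>(x, y). ?f x y) \<in> borel_measurable (\<nu> \<Otimes>\<^sub>M lborel)"
  proof -
    have "open {z :: 'a \<times> 'a. fst z \<in> ball 0 \<rho> \<and> fst z \<in> ball (snd z) 1}"
      unfolding mem_ball by (intro open_Collect_conj open_Collect_less continuous_intros)
    then have "{z :: 'a \<times> 'a. fst z \<in> ball 0 \<rho> \<and> fst z \<in> ball (snd z) 1} \<in> sets (\<nu> \<Otimes>\<^sub>M lborel)"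
      using sets_pair_measure_cong[OF sets sets_lborel[where 'a = 'a]] unfolding borel_prod
      by (simp only: borel_open)
    then have "indicator {z :: 'a \<times> 'a. fst z \<in> ball 0 \<rho> \<and> fst z \<in> ball (snd z) 1} \<in> borel_measurable (\<nu> \<Otimes>\<^sub>M (lborel::'a measure))"
      by (rule borel_measurable_indicator)
    then show ?thesis
      by (rule measurable_cong[THEN iffD1, rotated]) (auto simp: indicator_def)
  qed
  have unit: "emeasure lborel (ball x 1) = emeasure lborel (ball (0::'a) 1)" for x :: 'a
    by (simp add: emeasure_ball)
  have "emeasure \<nu> (ball 0 \<rho>) * emeasure lborel (ball (0::'a) 1)
      = (\<integral>\<^sup>+x. indicator (ball 0 \<rho>) x * emeasure lborel (ball (0::'a) 1) \<partial>\<nu>)"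
    by (subst nn_integral_multc) (auto intro!: borel_measurable_indicator simp: sets)
  also have "\<dots> = (\<integral>\<^sup>+x. (\<integral>\<^sup>+y. ?f x y \<partial>lborel) \<partial>\<nu>)"
  proof (rule nn_integral_cong)
    fix x :: 'a
    have "(\<integral>\<^sup>+y. ?f x y \<partial>lborel) = (\<integral>\<^sup>+y. indicator (ball 0 \<rho>) x * indicator (ball x 1) y \<partial>lborel)"
      by (intro nn_integral_cong) (auto simp: indicator_def dist_commute)
    then show "indicator (ball 0 \<rho>) x * emeasure lborel (ball (0::'a) 1) = (\<integral>\<^sup>+y. ?f x y \<partial>lborel)"
      by (simp add: nn_integral_cmult_indicator unit[of x])
  qed
  also have "\<dots> = (\<integral>\<^sup>+y. (\<integral>\<^sup>+x. ?f x y \<partial>\<nu>) \<partial>lborel)"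
    using P.Fubini'[OF meas] by simp
  also have "\<dots> \<le> (\<integral>\<^sup>+y. K * indicator (ball (0::'a) (2 * \<rho>)) y \<partial>lborel)"
  proof (rule nn_integral_mono)
    fix y :: 'a
    show "(\<integral>\<^sup>+x. ?f x y \<partial>\<nu>) \<le> K * indicator (ball 0 (2 * \<rho>)) y"
    proof (cases "y \<in> ball 0 (2 * \<rho>)")
      case True
      have "(\<integral>\<^sup>+x. ?f x y \<partial>\<nu>) \<le> (\<integral>\<^sup>+x. indicator (ball y 1) x \<partial>\<nu>)"
        by (intro nn_integral_mono) (auto simp: indicator_def)
      also have "\<dots> = emeasure \<nu> (ball y 1)" by (simp add: sets)
      finally show ?thesis using K[OF True] True by simp
    next
      case False
      have "?f x y = 0" for x
        using False \<rho> norm_triangle_sub[of y x] by (auto simp: indicator_def dist_norm)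
      then have "(\<integral>\<^sup>+x. ?f x y \<partial>\<nu>) = (\<integral>\<^sup>+x. 0 \<partial>\<nu>)"
        by (intro nn_integral_cong)
      then show ?thesis by (simp only: nn_integral_const mult_zero_left zero_le)
    qed
  qed
  also have "\<dots> = K * emeasure lborel (ball (0::'a) (2 * \<rho>))"
    by (simp add: nn_integral_cmult_indicator)
  finally show ?thesis .
qed

lemma integrable_powr_of_in_Lq:
  assumes S: "S \<in> lmeasurable" and h: "in_Lq q S h" and p: "0 \<le> p" "ereal p \<le> q"
  shows "integrable (lebesgue_on S) (\<lambda>x. norm (h x) powr p)"
proof -
  interpret finite_measure "lebesgue_on S"
    using S by (rule finite_measure_lebesgue_on)
  have [measurable]: "h \<in> borel_measurable (lebesgue_on S)" using h by (simp add: in_Lq_def)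
  show ?thesis
  proof (cases "q = \<infinity>")
    case True
    then obtain K where K: "AE x in lebesgue_on S. norm (h x) \<le> K" using h by (auto simp: in_Lq_def)
    show ?thesis
    proof (rule integrable_const_bound)
      show "AE x in lebesgue_on S. norm (norm (h x) powr p) \<le> K powr p"
        using K by eventually_elim (simp add: powr_mono2 p)
    qed measurable
  next
    case False
    then obtain r where r: "q = ereal r" using p by (cases q) auto
    show ?thesis
    proof (rule Bochner_Integration.integrable_bound[of _ "\<lambda>x. 1 + norm (h x) powr r"])
      show "integrable (lebesgue_on S) (\<lambda>x. 1 + norm (h x) powr r)"
        using h r by (simp add: in_Lq_def)
      have "t powr p \<le> 1 + t powr r" if "t \<ge> 0" for t
      proof (cases "t \<le> 1")
        case True
        then have "t powr p \<le> 1" using that p powr_mono2[of p t 1] by simp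
        then show ?thesis by (simp add: add_increasing2)
      next
        case False
        then have "t powr p \<le> t powr r" using p r by (intro powr_mono) auto
        then show ?thesis by simp
      qed
      then show "AE x in lebesgue_on S. norm (norm (h x) powr p) \<le> norm (1 + norm (h x) powr r)"
        by simp
    qed measurable
  qed
qed

lemma Lq_norm_infinity_AE:
  assumes h: "in_Lq \<infinity> S h" and S: "emeasure (lebesgue_on S) (space (lebesgue_on S)) \<noteq> 0"
  shows "AE x in lebesgue_on S. norm (h x) \<le> Lq_norm \<infinity> S h" and "0 \<le> Lq_norm \<infinity> S h"
proof -
  let ?e = "esssup (lebesgue_on S) (\<lambda>x. ereal (norm (h x)))"
  have [measurable]: "h \<in> borel_measurable (lebesgue_on S)" using h by (simp add: in_Lq_def)
  have meas: "(\<lambda>x. ereal (norm (h x))) \<in> borel_measurable (lebesgue_on S)"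
    by measurable
  have ae: "AE x in lebesgue_on S. ereal (norm (h x)) \<le> ?e" by (rule esssup_AE)
  obtain K where "AE x in lebesgue_on S. norm (h x) \<le> K" using h by (auto simp: in_Lq_def)
  then have "?e \<le> ereal K" by (intro esssup_I[OF meas]) simp
  moreover have "0 \<le> ?e"
    using esssup_AE_mono[of "\<lambda>_. 0 :: ereal" "lebesgue_on S" "\<lambda>x. ereal (norm (h x))"]
      esssup_const[OF S, of "0::ereal"] by simp
  ultimately obtain e where e: "?e = ereal e" "e \<ge> 0" by (cases ?e) auto
  then show "AE x in lebesgue_on S. norm (h x) \<le> Lq_norm \<infinity> S h" "0 \<le> Lq_norm \<infinity> S h"
    using ae by (auto simp: Lq_norm_def)
qed

lemma integral_unit_ball_le_Lq_ul_norm: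
  fixes h :: "'a::euclidean_space \<Rightarrow> 'b::euclidean_space"
  assumes h: "in_Lq (ereal r) (ball 0 R) h" and r: "r > 0" and x0: "x0 \<in> ball 0 R"
  shows "(LINT x|lebesgue_on (ball 0 R). indicator (ball x0 1) x * norm (h x) powr r) \<le> Lq_ul_norm (ereal r) R h powr r"
    and "0 \<le> Lq_ul_norm (ereal r) R h"
proof -
  let ?M = "lebesgue_on (ball (0::'a) R)"
  let ?I = "\<lambda>X. LINT x|?M. indicator X x * norm (h x) powr r"
  have int: "integrable ?M (\<lambda>x. norm (h x) powr r)" using h by (simp add: in_Lq_def)
  have I0: "0 \<le> ?I X" for X by simp
  have mono: "?I (ball y 1) \<le> (LINT x|?M. norm (h x) powr r)" for y
    by (rule integral_mono[OF _ int])
      (auto intro!: integrable_bounded_mult[OF int, where K = 1] borel_measurable_lebesgue_onI simp: indicator_def)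
  have eq: "Lq_norm (ereal r) (ball 0 R \<inter> ball y 1) h = ?I (ball y 1) powr (1 / r)" for y
  proof -
    have "lebesgue_on (ball 0 R \<inter> ball y 1) = restrict_space ?M (ball y 1)"
      by (simp add: restrict_restrict_space)
    moreover have "ball y 1 \<inter> space ?M \<in> sets ?M"
      by (simp add: sets_restrict_space_iff Int_commute)
    ultimately show ?thesis
      by (simp add: Lq_norm_def integral_restrict_space)
  qed
  have "bdd_above ((\<lambda>y. Lq_norm (ereal r) (ball 0 R \<inter> ball y 1) h) ` ball 0 R)"
    unfolding eq using mono r I0
    by (intro bdd_aboveI2[where M = "(LINT x|?M. norm (h x) powr r) powr (1 / r)"] powr_mono2) auto
  then have le: "?I (ball x0 1) powr (1 / r) \<le> Lq_ul_norm (ereal r) R h"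
    unfolding eq[symmetric] Lq_ul_norm_def using cSUP_upper[OF x0] by simp
  then show "0 \<le> Lq_ul_norm (ereal r) R h"
    by (rule order_trans[OF powr_ge_zero])
  have "?I (ball x0 1) = (?I (ball x0 1) powr (1 / r)) powr r"
    using r by (simp add: powr_powr)
  also have "\<dots> \<le> Lq_ul_norm (ereal r) R h powr r"
    using le r by (intro powr_mono2) auto
  finally show "?I (ball x0 1) \<le> Lq_ul_norm (ereal r) R h powr r" .
qed

text \<open>The uniformly local norm only sees unit balls. If \<open>\<rho> \<le> 1\<close>, the ball of radius \<open>\<rho>\<close> lies in one of
  them and the second bound on the norm is the right one. If \<open>\<rho> > 1\<close>, about \<open>\<rho>\<^sup>n\<close> unit balls are
  needed and the first bound supplies the decay.\<close>

lemma integral_ball_le_of_Lq_ul_norm: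
  fixes h :: "'a::euclidean_space \<Rightarrow> 'b::euclidean_space"
  assumes h: "in_Lq (ereal r) (ball 0 R) h" and r: "r > 0" and \<rho>: "0 < \<rho>" "2 * \<rho> \<le> R"
    and N: "Lq_ul_norm (ereal r) R h \<le> \<rho> powr (- j)"
      "Lq_ul_norm (ereal r) R h \<le> \<rho> powr (real DIM('a) / r - j)"
  shows "(LINT x|lebesgue_on (ball 0 R). indicator (ball 0 \<rho>) x * norm (h x) powr r)
    \<le> 2 ^ DIM('a) * \<rho> ^ DIM('a) * \<rho> powr (- (j * r))"
proof -
  let ?M = "lebesgue_on (ball (0::'a) R)"
  let ?I = "\<lambda>X. LINT x|?M. indicator X x * norm (h x) powr r"
  let ?N = "Lq_ul_norm (ereal r) R h"
  have int: "integrable ?M (\<lambda>x. norm (h x) powr r)" using h by (simp add: in_Lq_def)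
  have intX: "integrable ?M (\<lambda>x. indicator X x * norm (h x) powr r)" if "X \<in> sets borel" for X
    by (rule integrable_bounded_mult[OF int, where K = 1])
      (use that in \<open>auto intro!: borel_measurable_lebesgue_onI simp: indicator_def\<close>)
  have N0: "0 \<le> ?N" and unit: "?I (ball y 1) \<le> ?N powr r" if "y \<in> ball 0 R" for y
    using integral_unit_ball_le_Lq_ul_norm[OF h r that] by auto
  have zero: "0 \<in> ball (0::'a) R" using \<rho> by simp
  show ?thesis
  proof (cases "\<rho> \<le> 1")
    case True
    have "?I (ball 0 \<rho>) \<le> ?I (ball 0 1)"
      using True by (intro integral_mono intX) (auto simp: indicator_def)
    also have "\<dots> \<le> ?N powr r" by (rule unit[OF zero])
    also have "\<dots> \<le> (\<rho> powr (real DIM('a) / r - j)) powr r"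
      using N(2) N0[OF zero] r by (intro powr_mono2) auto
    also have "\<dots> = \<rho> ^ DIM('a) * \<rho> powr (- (j * r))"
      using r \<rho> by (simp add: powr_powr powr_realpow[symmetric] powr_add[symmetric] algebra_simps)
    also have "\<dots> \<le> 2 ^ DIM('a) * (\<rho> ^ DIM('a) * \<rho> powr (- (j * r)))"
      using mult_right_mono[of 1 "2 ^ DIM('a)" "\<rho> ^ DIM('a) * \<rho> powr (- (j * r))"] \<rho> by simp
    finally show ?thesis by (simp add: mult.assoc)
  next
    case False
    \<comment> \<open>The measure with density \<open>|h|\<^sup>r\<close>, transported to the Borel sets so that its product with
      Lebesgue measure contains the open sets.\<close>
    define \<nu> where "\<nu> = distr (density ?M (\<lambda>x. ennreal (norm (h x) powr r))) borel (\<lambda>x. x)"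
    have [measurable]: "h \<in> borel_measurable ?M" using h by (simp add: in_Lq_def)
    have id: "(\<lambda>x. x) \<in> ?M \<rightarrow>\<^sub>M borel" by (rule borel_measurable_lebesgue_onI) simp
    have \<nu>: "emeasure \<nu> X = ennreal (?I X)" if X: "X \<in> sets borel" for X
    proof -
      have "X \<inter> space ?M \<in> sets ?M"
        using measurable_sets[OF id X] by simp
      then have "emeasure \<nu> X = (\<integral>\<^sup>+x. ennreal (norm (h x) powr r) * indicator (X \<inter> space ?M) x \<partial>?M)"
        unfolding \<nu>_def using id X by (simp add: emeasure_distr emeasure_density)
      also have "\<dots> = (\<integral>\<^sup>+x. ennreal (indicator X x * norm (h x) powr r) \<partial>?M)"
        by (intro nn_integral_cong) (auto simp: indicator_def)
      also have "\<dots> = ennreal (?I X)"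
        by (rule nn_integral_eq_integral[OF intX[OF X]]) simp
      finally show ?thesis .
    qed
    have fin: "finite_measure \<nu>"
      using \<nu>[of UNIV] by (intro finite_measureI) (simp add: \<nu>_def)
    have "emeasure \<nu> (ball 0 \<rho>) * emeasure lborel (ball (0::'a) 1)
        \<le> ennreal (?N powr r) * emeasure lborel (ball (0::'a) (2 * \<rho>))"
      by (rule emeasure_ball_le_unit_balls[OF _ fin]) (use False \<rho> unit in \<open>auto simp: \<nu>_def[THEN arg_cong[of _ _ sets]] \<nu>\<close>)
    then have "ennreal (?I (ball 0 \<rho>) * unit_ball_vol DIM('a))
        \<le> ennreal (?N powr r * (unit_ball_vol DIM('a) * (2 * \<rho>) ^ DIM('a)))"
      using \<rho> by (simp add: \<nu> emeasure_ball ennreal_mult[symmetric] del: ennreal_le_iff)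
    then have "?I (ball 0 \<rho>) * unit_ball_vol DIM('a) \<le> ?N powr r * (unit_ball_vol DIM('a) * (2 * \<rho>) ^ DIM('a))"
      using \<rho> by (subst (asm) ennreal_le_iff) auto
    then have "?I (ball 0 \<rho>) \<le> ?N powr r * (2 * \<rho>) ^ DIM('a)"
      using unit_ball_vol_pos[of "real DIM('a)"] by (simp add: mult.left_commute[of _ "unit_ball_vol _"] mult.commute[of _ "unit_ball_vol _"])
    also have "\<dots> \<le> (\<rho> powr (- j)) powr r * (2 * \<rho>) ^ DIM('a)"
      using N(1) N0[OF zero] r \<rho> by (intro mult_right_mono powr_mono2) auto
    also have "\<dots> = 2 ^ DIM('a) * \<rho> ^ DIM('a) * \<rho> powr (- (j * r))"
      by (simp add: powr_powr power_mult_distrib)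
    finally show ?thesis .
  qed
qed

text \<open>With \<open>\<tau> = \<rho> powr (- j)\<close>, the pointwise inequality
  \<open>t powr p \<le> \<tau> powr p + \<tau> powr (p - r) * t powr r\<close> (distinguish \<open>t \<le> \<tau>\<close> and \<open>t > \<tau>\<close>) takes the
  place of Hoelder's inequality. The condition \<open>j * p = 2\<close> expresses the scaling of the equation: it
  is used with \<open>p = 2\<close>, \<open>j = 1\<close> for \<open>b\<^sub>2\<close> and with \<open>p = 1\<close>, \<open>j = 2\<close> for \<open>c\<close>.\<close>

lemma integral_ball_powr_le:
  fixes h :: "'a::euclidean_space \<Rightarrow> 'b::euclidean_space"
  assumes h: "in_Lq q (ball 0 R) h" and \<rho>: "0 < \<rho>" "2 * \<rho> \<le> R"
    and p: "0 < p" "ereal p \<le> q" "j * p = 2"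
    and N: "Lq_ul_norm q R h \<le> \<rho> powr (- j)"
      "q \<noteq> \<infinity> \<Longrightarrow> Lq_ul_norm q R h \<le> \<rho> powr (real DIM('a) / real_of_ereal q - j)"
  shows "(LINT x|lebesgue_on (ball 0 R). indicator (ball 0 \<rho>) x * norm (h x) powr p)
    \<le> (unit_ball_vol DIM('a) + 2 ^ DIM('a)) * \<rho> ^ DIM('a) / \<rho>\<^sup>2"
proof -
  let ?M = "lebesgue_on (ball (0::'a) R)"
  let ?B = "indicator (ball 0 \<rho>) :: 'a \<Rightarrow> real"
  define \<tau> where "\<tau> = \<rho> powr (- j)"
  have \<tau>: "\<tau> > 0" using \<rho> by (simp add: \<tau>_def)
  have \<tau>p: "\<tau> powr p = 1 / \<rho>\<^sup>2"
  proof -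
    have "\<tau> powr p = \<rho> powr (- (j * p))" by (simp only: \<tau>_def powr_powr mult_minus_left)
    then show ?thesis using \<rho> by (simp add: p powr_minus inverse_eq_divide)
  qed
  interpret finite_measure ?M by (rule finite_measure_lebesgue_on) simp
  have meas: "?B \<in> borel_measurable ?M" by (intro borel_measurable_lebesgue_onI borel_measurable_indicator) simp
  have intB: "integrable ?M (\<lambda>x. ?B x * f x)" if "integrable ?M f" for f :: "'a \<Rightarrow> real"
    by (rule integrable_bounded_mult[OF that meas, where K = 1]) (simp add: indicator_def)
  have intp: "integrable ?M (\<lambda>x. norm (h x) powr p)"
    by (rule integrable_powr_of_in_Lq[OF _ h]) (use p in auto)
  have B: "(LINT x|?M. ?B x) = unit_ball_vol DIM('a) * \<rho> ^ DIM('a)"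
  proof -
    have "ball 0 \<rho> \<subseteq> ball (0::'a) R" using \<rho> by (intro subset_ball) simp
    then have "(LINT x|?M. ?B x) = measure ?M (ball 0 \<rho>)"
      by (simp add: Int_absorb2)
    also have "\<dots> = measure lborel (ball (0::'a) \<rho>)"
      using \<rho> by (subst measure_restrict_space) (auto simp: measure_completion)
    finally show ?thesis using \<rho> by (simp add: content_ball)
  qed
  show ?thesis
  proof (cases "q = \<infinity>")
    case True
    have "emeasure ?M (space ?M) \<noteq> 0"
      using \<rho> unit_ball_vol_pos[of "real DIM('a)"]
      by (simp add: emeasure_restrict_space emeasure_ball ennreal_zero_less_mult_iff less_imp_neq[symmetric])
    then have "AE x in ?M. norm (h x) \<le> Lq_norm \<infinity> (ball 0 R) h"
      using Lq_norm_infinity_AE(1)[of "ball 0 R" h] h True by blast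
    then have "AE x in ?M. norm (h x) \<le> \<tau>"
      by eventually_elim (use N(1) True in \<open>simp add: Lq_ul_norm_def \<tau>_def\<close>)
    then have "AE x in ?M. ?B x * norm (h x) powr p \<le> ?B x * (1 / \<rho>\<^sup>2)"
      unfolding \<tau>p[symmetric] by eventually_elim (use p in \<open>auto intro!: mult_left_mono powr_mono2\<close>)
    then have "(LINT x|?M. ?B x * norm (h x) powr p) \<le> (LINT x|?M. ?B x * (1 / \<rho>\<^sup>2))"
      by (intro integral_mono_AE intB intp) auto
    also have "\<dots> = unit_ball_vol DIM('a) * \<rho> ^ DIM('a) / \<rho>\<^sup>2"
      using B by simp
    also have "\<dots> \<le> (unit_ball_vol DIM('a) + 2 ^ DIM('a)) * \<rho> ^ DIM('a) / \<rho>\<^sup>2"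
      using \<rho> by (intro divide_right_mono mult_right_mono) auto
    finally show ?thesis .
  next
    case False
    then obtain r where r: "q = ereal r" "p \<le> r" using p by (cases q) auto
    have intr: "integrable ?M (\<lambda>x. norm (h x) powr r)" using h r by (simp add: in_Lq_def)
    have "?B x * norm (h x) powr p \<le> 1 / \<rho>\<^sup>2 * ?B x + \<tau> powr (p - r) * (?B x * norm (h x) powr r)" for x
    proof -
      have "t powr p \<le> \<tau> powr p + \<tau> powr (p - r) * t powr r" if "t \<ge> 0" for t
      proof (cases "t \<le> \<tau>")
        case True
        then have "t powr p \<le> \<tau> powr p" using that p by (intro powr_mono2) auto
        then show ?thesis by (simp add: add_increasing2)
      next
        case False
        then have "t powr (p - r) \<le> \<tau> powr (p - r)"
          using \<tau> r by (intro powr_mono2') auto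
        then have "t powr (p - r) * t powr r \<le> \<tau> powr (p - r) * t powr r"
          by (intro mult_right_mono) auto
        then show ?thesis by (simp add: powr_add[symmetric] add_increasing)
      qed
      from this[of "norm (h x)"] show ?thesis
        using \<tau>p by (auto simp: indicator_def)
    qed
    then have "(LINT x|?M. ?B x * norm (h x) powr p)
        \<le> (LINT x|?M. 1 / \<rho>\<^sup>2 * ?B x + \<tau> powr (p - r) * (?B x * norm (h x) powr r))"
      by (intro integral_mono intB intp intr Bochner_Integration.integrable_add integrable_mult_right)
        (auto simp: intB[of "\<lambda>_. 1", simplified])
    also have "\<dots> = 1 / \<rho>\<^sup>2 * (LINT x|?M. ?B x) + \<tau> powr (p - r) * (LINT x|?M. ?B x * norm (h x) powr r)"
      using intB[OF intr] intB[of "\<lambda>_. 1", simplified] by simp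
    also have "\<dots> \<le> 1 / \<rho>\<^sup>2 * (unit_ball_vol DIM('a) * \<rho> ^ DIM('a)) +
        \<tau> powr (p - r) * (2 ^ DIM('a) * \<rho> ^ DIM('a) * \<rho> powr (- (j * r)))"
      using integral_ball_le_of_Lq_ul_norm[of r R h \<rho> j] h N r p \<rho> False unfolding B
      by (intro add_left_mono mult_left_mono) auto
    also have "\<tau> powr (p - r) * (2 ^ DIM('a) * \<rho> ^ DIM('a) * \<rho> powr (- (j * r)))
        = (2 ^ DIM('a) * \<rho> ^ DIM('a)) * (\<tau> powr (p - r) * \<rho> powr (- (j * r)))"
      by simp
    also have "\<tau> powr (p - r) * \<rho> powr (- (j * r)) = \<tau> powr p"
      using \<rho> by (simp add: \<tau>_def powr_powr powr_add[symmetric] algebra_simps)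
    finally show ?thesis
      unfolding \<tau>p by (simp add: algebra_simps add_divide_distrib)
  qed
qed

section \<open>The energy estimate\<close>

text \<open>The algebra of the energy estimate at one point, with \<open>D\<close> for the gradient of \<open>u\<close>, \<open>E\<close> for \<open>A D\<close> and
  \<open>g\<close> for the gradient of the cut-off function \<open>\<phi>\<close>. The derivative of \<open>G(u)\<close> produces the negative
  term \<open>- lam * (\<phi> G |D|)\<^sup>2\<close>. Each of the three other terms with a factor \<open>D\<close> takes a quarter of it
  by Young's inequality, and what remains contains neither \<open>u\<close> nor its gradient.\<close>

lemma energy_density_le:
  fixes D E g b1 b2 :: "real^'n" and lam K G G' u c \<phi> :: real
  assumes lam: "lam > 0" "lam * (D \<bullet> D) \<le> D \<bullet> E"
    and cross: "2 * (\<phi> * G) * (E \<bullet> g) \<le> lam / 4 * ((\<phi> * G)\<^sup>2 * (D \<bullet> D)) + K * (g \<bullet> g)"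
    and G': "G' \<le> - G\<^sup>2" "\<bar>G'\<bar> \<le> 2 * G\<^sup>2" and u: "0 \<le> u" "0 \<le> G" "u * G \<le> 1 / 2"
  shows "(E + u *\<^sub>R b1) \<bullet> (G *\<^sub>R (2 * \<phi>) *\<^sub>R g + (\<phi>\<^sup>2 * G') *\<^sub>R D) - (b2 \<bullet> D + c * u) * (\<phi>\<^sup>2 * G)
    \<le> (K + 1 / 2) * (norm g)\<^sup>2 + (1 / 2 + 1 / lam) * (\<phi>\<^sup>2 * (norm b1)\<^sup>2) + 1 / lam * (\<phi>\<^sup>2 * (norm b2)\<^sup>2)
      + 1 / 2 * (\<phi>\<^sup>2 * \<bar>c\<bar>)"
proof -
  define P where "P = \<bar>\<phi>\<bar> * G * norm D"
  have \<phi>2: "\<phi>\<^sup>2 = \<bar>\<phi>\<bar> * \<bar>\<phi>\<bar>" by (simp add: power2_eq_square)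
  have P0: "P \<ge> 0" using u by (simp add: P_def)
  have P2: "(\<phi> * G)\<^sup>2 * (D \<bullet> D) = P\<^sup>2"
    by (simp add: P_def power_mult_distrib power2_norm_eq_inner)
  have uG: "0 \<le> u * G" using u by simp
  have young: "P * a \<le> lam / 4 * P\<^sup>2 + 1 / lam * a\<^sup>2" for a
  proof -
    have "0 \<le> (sqrt lam / 2 * P - a / sqrt lam)\<^sup>2" by simp
    then show ?thesis
      using lam(1) by (simp add: power2_diff power_mult_distrib power_divide field_simps)
        (simp add: power2_eq_square algebra_simps)
  qed
  have T1: "\<phi>\<^sup>2 * G' * (E \<bullet> D) \<le> - (lam * P\<^sup>2)"
  proof -
    have "0 \<le> lam * (D \<bullet> D)" using lam(1) by simp
    then have ED: "0 \<le> E \<bullet> D" "lam * (D \<bullet> D) \<le> E \<bullet> D" using lam(2) by (simp_all add: inner_commute)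
    have "\<phi>\<^sup>2 * G' * (E \<bullet> D) \<le> \<phi>\<^sup>2 * (- G\<^sup>2) * (E \<bullet> D)"
      using G'(1) ED(1) by (intro mult_right_mono mult_left_mono) auto
    also have "\<dots> \<le> - (\<phi>\<^sup>2 * G\<^sup>2 * (lam * (D \<bullet> D)))"
      using mult_left_mono[OF ED(2), of "\<phi>\<^sup>2 * G\<^sup>2"] by simp
    finally show ?thesis unfolding P2[symmetric] by (simp add: power_mult_distrib algebra_simps)
  qed
  have T3: "u * G * (2 * \<phi>) * (b1 \<bullet> g) \<le> 1 / 2 * (norm g)\<^sup>2 + 1 / 2 * (\<phi>\<^sup>2 * (norm b1)\<^sup>2)"
  proof -
    have "u * G * (2 * \<phi>) * (b1 \<bullet> g) = (2 * (u * G)) * (\<phi> * (b1 \<bullet> g))" by simp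
    also have "\<dots> \<le> (2 * (u * G)) * \<bar>\<phi> * (b1 \<bullet> g)\<bar>"
      using uG by (intro mult_left_mono) auto
    also have "\<dots> \<le> 1 * \<bar>\<phi> * (b1 \<bullet> g)\<bar>"
      using u by (intro mult_right_mono) auto
    also have "\<dots> \<le> (\<bar>\<phi>\<bar> * norm b1) * norm g"
      by (simp add: abs_mult mult.assoc mult_left_mono Cauchy_Schwarz_ineq2)
    also have "\<dots> \<le> 1 / 2 * (norm g)\<^sup>2 + 1 / 2 * (\<phi>\<^sup>2 * (norm b1)\<^sup>2)"
      using sum_squares_bound[of "\<bar>\<phi>\<bar> * norm b1" "norm g"] by (simp add: power_mult_distrib)
    finally show ?thesis .
  qed
  have T4: "u * (\<phi>\<^sup>2 * G') * (b1 \<bullet> D) \<le> lam / 4 * P\<^sup>2 + 1 / lam * (\<phi>\<^sup>2 * (norm b1)\<^sup>2)"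
  proof -
    have "u * (\<phi>\<^sup>2 * G') * (b1 \<bullet> D) \<le> \<bar>u * (\<phi>\<^sup>2 * G') * (b1 \<bullet> D)\<bar>" by simp
    also have "\<dots> = (u * \<phi>\<^sup>2) * (\<bar>G'\<bar> * \<bar>b1 \<bullet> D\<bar>)"
      using u by (simp add: abs_mult)
    also have "\<dots> \<le> (u * \<phi>\<^sup>2) * (2 * G\<^sup>2 * (norm b1 * norm D))"
      using u G' by (intro mult_left_mono mult_mono Cauchy_Schwarz_ineq2) auto
    also have "\<dots> = (2 * (u * G)) * (P * (\<bar>\<phi>\<bar> * norm b1))"
      by (simp only: P_def \<phi>2 power2_eq_square[of G] mult_ac)
    also have "\<dots> \<le> 1 * (P * (\<bar>\<phi>\<bar> * norm b1))"
      using u P0 by (intro mult_right_mono) auto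
    also have "\<dots> \<le> lam / 4 * P\<^sup>2 + 1 / lam * (\<phi>\<^sup>2 * (norm b1)\<^sup>2)"
      using young[of "\<bar>\<phi>\<bar> * norm b1"] by (simp add: power_mult_distrib)
    finally show ?thesis .
  qed
  have T5: "- (b2 \<bullet> D) * (\<phi>\<^sup>2 * G) \<le> lam / 4 * P\<^sup>2 + 1 / lam * (\<phi>\<^sup>2 * (norm b2)\<^sup>2)"
  proof -
    have "- (b2 \<bullet> D) * (\<phi>\<^sup>2 * G) \<le> (norm b2 * norm D) * (\<phi>\<^sup>2 * G)"
      using Cauchy_Schwarz_ineq2[of b2 D] u by (intro mult_right_mono) auto
    also have "\<dots> = P * (\<bar>\<phi>\<bar> * norm b2)"
      by (simp only: P_def \<phi>2 power2_eq_square[of G] mult_ac)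
    also have "\<dots> \<le> lam / 4 * P\<^sup>2 + 1 / lam * (\<phi>\<^sup>2 * (norm b2)\<^sup>2)"
      using young[of "\<bar>\<phi>\<bar> * norm b2"] by (simp add: power_mult_distrib)
    finally show ?thesis .
  qed
  have T6: "- (c * u) * (\<phi>\<^sup>2 * G) \<le> 1 / 2 * (\<phi>\<^sup>2 * \<bar>c\<bar>)"
  proof -
    have "- (c * u) * (\<phi>\<^sup>2 * G) = (u * G) * (\<phi>\<^sup>2 * (- c))" by simp
    also have "\<dots> \<le> (u * G) * (\<phi>\<^sup>2 * \<bar>c\<bar>)" using uG by (intro mult_left_mono) auto
    also have "\<dots> \<le> 1 / 2 * (\<phi>\<^sup>2 * \<bar>c\<bar>)" using u by (intro mult_right_mono) auto
    finally show ?thesis .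
  qed
  have "(E + u *\<^sub>R b1) \<bullet> (G *\<^sub>R (2 * \<phi>) *\<^sub>R g + (\<phi>\<^sup>2 * G') *\<^sub>R D) - (b2 \<bullet> D + c * u) * (\<phi>\<^sup>2 * G)
    = 2 * (\<phi> * G) * (E \<bullet> g) + \<phi>\<^sup>2 * G' * (E \<bullet> D) + u * G * (2 * \<phi>) * (b1 \<bullet> g) + u * (\<phi>\<^sup>2 * G') * (b1 \<bullet> D)
      + - (b2 \<bullet> D) * (\<phi>\<^sup>2 * G) + - (c * u) * (\<phi>\<^sup>2 * G)"
    by (simp add: inner_left_distrib inner_right_distrib algebra_simps)
  also have "\<dots> \<le> (lam / 4 * P\<^sup>2 + K * (norm g)\<^sup>2) + - (lam * P\<^sup>2)
      + (1 / 2 * (norm g)\<^sup>2 + 1 / 2 * (\<phi>\<^sup>2 * (norm b1)\<^sup>2))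
      + (lam / 4 * P\<^sup>2 + 1 / lam * (\<phi>\<^sup>2 * (norm b1)\<^sup>2))
      + (lam / 4 * P\<^sup>2 + 1 / lam * (\<phi>\<^sup>2 * (norm b2)\<^sup>2)) + 1 / 2 * (\<phi>\<^sup>2 * \<bar>c\<bar>)"
    using cross unfolding P2 power2_norm_eq_inner[of g, symmetric]
    by (intro add_mono T1 T3 T4 T5 T6)
  also have "\<dots> \<le> (K + 1 / 2) * (norm g)\<^sup>2 + (1 / 2 + 1 / lam) * (\<phi>\<^sup>2 * (norm b1)\<^sup>2) + 1 / lam * (\<phi>\<^sup>2 * (norm b2)\<^sup>2)
      + 1 / 2 * (\<phi>\<^sup>2 * \<bar>c\<bar>)"
  proof -
    have "0 \<le> lam * P\<^sup>2" using lam(1) by simp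
    then show ?thesis by (simp add: distrib_right)
  qed
  finally show ?thesis .
qed

text \<open>Integrating the pointwise inequality bounds \<open>\<mu>\<close> times the integral of \<open>\<phi>\<^sup>2 u G(u)\<close>, with \<open>G\<close> the
  regularised reciprocal, independently of \<open>\<epsilon>\<close>. As \<open>\<epsilon>\<close> tends to 0, \<open>u G(u)\<close> tends to \<open>1 / 2\<close>.\<close>

lemma eigenvalue_energy_bound:
  fixes u c :: "real^'n \<Rightarrow> real" and B :: "real^'n \<Rightarrow> real^'n^'n"
  assumes \<Omega>: "\<Omega> \<in> lmeasurable" and H: "H10 \<Omega> u Du" and pos: "AE x in lebesgue_on \<Omega>. u x > 0"
    and B: "B \<in> borel_measurable (lebesgue_on \<Omega>)" "\<And>x. x \<in> \<Omega> \<Longrightarrow> norm (B x) \<le> \<beta>"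
    and lam: "lam > 0" "\<And>x \<xi>. x \<in> \<Omega> \<Longrightarrow> lam * (\<xi> \<bullet> \<xi>) \<le> \<xi> \<bullet> (B x *v \<xi>)"
    and b1: "b1 \<in> borel_measurable (lebesgue_on \<Omega>)" "\<And>x. x \<in> \<Omega> \<Longrightarrow> norm (b1 x) \<le> K1"
    and b2: "in_Lq 2 \<Omega> b2" and c: "in_Lq 2 \<Omega> c"
    and \<phi>: "test_function \<Omega> \<phi>"
    and cross: "\<And>x \<xi> \<zeta>. x \<in> \<Omega> \<Longrightarrow> \<phi> x \<noteq> 0 \<Longrightarrow> 2 * ((B x *v \<xi>) \<bullet> \<zeta>) \<le> lam / 4 * (\<xi> \<bullet> \<xi>) + K * (\<zeta> \<bullet> \<zeta>)"
    and K: "0 \<le> K"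
    and weak: "\<And>\<psi>. test_function \<Omega> \<psi> \<Longrightarrow>
      neg_L_form \<Omega> B b1 b2 c u Du \<psi> = (LINT x|lebesgue_on \<Omega>. \<mu> * u x * \<psi> x)"
  shows "\<mu> * (LINT x|lebesgue_on \<Omega>. (\<phi> x)\<^sup>2) \<le> 2 * (LINT x|lebesgue_on \<Omega>.
      (K + 1 / 2) * (norm (gradient \<phi> x))\<^sup>2 + (1 / 2 + 1 / lam) * ((\<phi> x)\<^sup>2 * (norm (b1 x))\<^sup>2)
      + 1 / lam * ((\<phi> x)\<^sup>2 * (norm (b2 x))\<^sup>2) + 1 / 2 * ((\<phi> x)\<^sup>2 * \<bar>c x\<bar>))"
    (is "_ \<le> 2 * (LINT x|_. ?Q x)")
proof -
  let ?M = "lebesgue_on \<Omega>"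
  interpret finite_measure ?M using \<Omega> by (rule finite_measure_lebesgue_on)
  have u: "in_Lq 2 \<Omega> u" and Du: "in_Lq 2 \<Omega> Du" using H by (auto simp: H10_def)
  have [measurable]: "u \<in> borel_measurable ?M" "Du \<in> borel_measurable ?M" "B \<in> borel_measurable ?M"
      "b1 \<in> borel_measurable ?M" "b2 \<in> borel_measurable ?M" "c \<in> borel_measurable ?M"
      "\<phi> \<in> borel_measurable ?M" "gradient \<phi> \<in> borel_measurable ?M"
    using u Du B b1 b2 c test_function_measurable[OF \<phi>] by (auto simp: in_Lq_2_iff)
  have BD [measurable]: "(\<lambda>x. B x *v Du x) \<in> borel_measurable ?M"
    by (rule borel_measurable_matrix_vector_mult) measurable
  define W where "W x = B x *v Du x + u x *\<^sub>R b1 x" for x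
  have W: "in_Lq 2 \<Omega> W"
    unfolding W_def[abs_def]
  proof (rule in_Lq_2_add)
    show "in_Lq 2 \<Omega> (\<lambda>x. B x *v Du x)"
      by (rule in_Lq_2_bounded_scale[OF Du _ BD])
        (rule order_trans[OF norm_matrix_vector_mult_le mult_right_mono[OF B(2)]], auto)
    show "in_Lq 2 \<Omega> (\<lambda>x. u x *\<^sub>R b1 x)"
    proof (rule in_Lq_2_bounded_scale[OF u])
      show "norm (u x *\<^sub>R b1 x) \<le> K1 * norm (u x)" if "x \<in> \<Omega>" for x
        using mult_left_mono[OF b1(2)[OF that], of "\<bar>u x\<bar>"] by (simp add: mult.commute)
    qed measurable
  qed
  define h where "h x = b2 x \<bullet> Du x + c x * u x" for x
  have h: "integrable ?M h"
    unfolding h_def[abs_def]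
    by (intro Bochner_Integration.integrable_add integrable_inner_L2 integrable_mult_L2 b2 Du c u)
  have iu: "integrable ?M u"
    using integrable_mult_L2[OF u in_Lq_2_bounded[OF \<Omega> borel_measurable_const[of 1], of 1]] by simp
  have h\<mu>: "integrable ?M (\<lambda>x. h x + \<mu> * u x)" using h iu by simp
  have weak': "(LINT x|?M. W x \<bullet> gradient \<psi> x) = (LINT x|?M. (h x + \<mu> * u x) * \<psi> x)"
    if \<psi>: "test_function \<Omega> \<psi>" for \<psi>
  proof -
    obtain C where C: "\<And>x. \<bar>\<psi> x\<bar> \<le> C" using test_function_bounded[OF \<psi>] by metis
    have bd: "integrable ?M (\<lambda>x. \<psi> x * f x)" if "integrable ?M f" for f
      by (rule integrable_bounded_mult[OF that test_function_measurable(1)[OF \<psi>] C])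
    have i1: "integrable ?M (\<lambda>x. W x \<bullet> gradient \<psi> x)"
      by (rule integrable_inner_L2[OF W in_Lq_2_test_function(2)[OF \<Omega> \<psi>]])
    have "neg_L_form \<Omega> B b1 b2 c u Du \<psi> = (LINT x|?M. W x \<bullet> gradient \<psi> x - \<psi> x * h x)"
      unfolding neg_L_form_def by (intro Bochner_Integration.integral_cong) (auto simp: W_def h_def algebra_simps)
    also have "\<dots> = (LINT x|?M. W x \<bullet> gradient \<psi> x) - (LINT x|?M. \<psi> x * h x)"
      by (rule Bochner_Integration.integral_diff[OF i1 bd[OF h]])
    finally have "(LINT x|?M. W x \<bullet> gradient \<psi> x) = (LINT x|?M. \<psi> x * h x) + (LINT x|?M. \<mu> * u x * \<psi> x)"
      using weak[OF \<psi>] by simp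
    also have "\<dots> = (LINT x|?M. \<psi> x * h x + \<mu> * u x * \<psi> x)"
      using bd[OF h] bd[OF integrable_mult_right[OF iu, of \<mu>]]
      by (intro Bochner_Integration.integral_add[symmetric]) (auto simp: mult_ac)
    finally show ?thesis by (simp add: algebra_simps)
  qed
  let ?\<eta> = "\<lambda>x. \<phi> x * \<phi> x"
  have \<eta>: "test_function \<Omega> ?\<eta>"
    using \<phi> by (intro test_function_mult) (auto simp: test_function_def)
  have grad_\<eta>: "gradient ?\<eta> x = (2 * \<phi> x) *\<^sub>R gradient \<phi> x" for x
  proof -
    have "Ck (Suc 0) \<phi>" using \<phi> unfolding test_function_def by blast
    then have d: "\<phi> differentiable (at x)" by (rule Ck_differentiable)
    show ?thesis using gradient_mult[OF d d] by (simp add: scaleR_2[symmetric])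
  qed
  obtain C where C: "\<And>x. \<bar>\<phi> x\<bar> \<le> C" using test_function_bounded[OF \<phi>] by metis
  have C2: "\<bar>(\<phi> x)\<^sup>2\<bar> \<le> C\<^sup>2" for x using power_mono[OF C[of x], of 2] by simp
  have bd\<phi>: "integrable ?M (\<lambda>x. (\<phi> x)\<^sup>2 * f x)" if "integrable ?M f" for f
    by (rule integrable_bounded_mult[OF that _ C2]) measurable
  have iQ: "integrable ?M ?Q"
  proof (intro Bochner_Integration.integrable_add integrable_mult_right bd\<phi>)
    show "integrable ?M (\<lambda>x. (norm (gradient \<phi> x))\<^sup>2)"
      using in_Lq_2_test_function(2)[OF \<Omega> \<phi>] by (simp add: in_Lq_2_iff)
    show "integrable ?M (\<lambda>x. (norm (b1 x))\<^sup>2)"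
    proof -
      have "in_Lq 2 \<Omega> b1" by (rule in_Lq_2_bounded[OF \<Omega> b1(1), of K1]) (use b1(2) in auto)
      then show ?thesis by (simp add: in_Lq_2_iff)
    qed
    show "integrable ?M (\<lambda>x. (norm (b2 x))\<^sup>2)" using b2 by (simp add: in_Lq_2_iff)
    show "integrable ?M (\<lambda>x. \<bar>c x\<bar>)"
      using integrable_mult_L2[OF c in_Lq_2_bounded[OF \<Omega> borel_measurable_const[of 1], of 1]] by simp
  qed
  have main: "\<mu> * (LINT x|?M. (\<phi> x)\<^sup>2 * (u x * soft_recip \<epsilon> (u x))) \<le> (LINT x|?M. ?Q x)" if \<epsilon>: "\<epsilon> > 0" for \<epsilon>
  proof -
    let ?G = "\<lambda>x. soft_recip \<epsilon> (u x)" and ?G' = "\<lambda>x. soft_recip' \<epsilon> (u x)"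
    let ?L = "\<lambda>x. W x \<bullet> (?G x *\<^sub>R gradient ?\<eta> x + (?\<eta> x * ?G' x) *\<^sub>R Du x)"
    note w = weak_form_soft_recip[OF \<Omega> H W h\<mu> weak' \<eta> \<epsilon>]
    have [measurable]: "soft_recip \<epsilon> \<in> borel_measurable borel"
      using continuous_soft_recip[OF \<epsilon>] by (auto intro: borel_measurable_continuous_onI)
    have bdG: "integrable ?M (\<lambda>x. (?\<eta> x * ?G x) * f x)" if "integrable ?M f" for f
    proof (rule integrable_bounded_mult[OF that])
      show "\<bar>?\<eta> x * ?G x\<bar> \<le> C\<^sup>2 * (1 / \<epsilon>)" for x
        unfolding abs_mult[of "?\<eta> x"] using C2[of x] soft_recip_bounds[OF \<epsilon>, of "u x"]
        by (intro mult_mono) (auto simp: power2_eq_square)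
    qed measurable
    have "\<mu> * (LINT x|?M. (\<phi> x)\<^sup>2 * (u x * ?G x)) = (LINT x|?M. (?\<eta> x * ?G x) * (\<mu> * u x))"
      unfolding integral_mult_right_zero[symmetric]
      by (intro Bochner_Integration.integral_cong) (auto simp: power2_eq_square)
    also have "\<dots> = (LINT x|?M. (h x + \<mu> * u x) * (?\<eta> x * ?G x)) - (LINT x|?M. (?\<eta> x * ?G x) * h x)"
      using bdG[OF h] bdG[OF integrable_mult_right[OF iu, of \<mu>]]
      by (simp add: distrib_left mult.commute[of _ "?\<eta> _ * ?G _"])
    also have "\<dots> = (LINT x|?M. ?L x - (?\<eta> x * ?G x) * h x)"
      using Bochner_Integration.integral_diff[OF w(1) bdG[OF h]] w(3) by simp
    also have "\<dots> \<le> (LINT x|?M. ?Q x)"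
    proof (rule integral_mono_AE[OF Bochner_Integration.integrable_diff[OF w(1) bdG[OF h]] iQ])
      show "AE x in ?M. ?L x - (?\<eta> x * ?G x) * h x \<le> ?Q x"
        using pos AE_space
      proof eventually_elim
        case (elim x)
        then have x: "x \<in> \<Omega>" and ux: "0 \<le> u x" by auto
        have "2 * (\<phi> x * ?G x) * ((B x *v Du x) \<bullet> gradient \<phi> x)
            \<le> lam / 4 * ((\<phi> x * ?G x)\<^sup>2 * (Du x \<bullet> Du x)) + K * (gradient \<phi> x \<bullet> gradient \<phi> x)"
        proof (cases "\<phi> x = 0")
          case True
          then show ?thesis using K by simp
        next
          case False
          show ?thesis
            using cross[OF x False, of "(\<phi> x * ?G x) *\<^sub>R Du x" "gradient \<phi> x"]
            by (simp add: matrix_vector_mult_scaleR power2_eq_square mult_ac)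
        qed
        from energy_density_le[OF lam(1) lam(2)[OF x] this soft_recip_bounds_nonneg(1,2)[OF \<epsilon> ux] ux
            less_imp_le[OF soft_recip_bounds(1)[OF \<epsilon>]] soft_recip_bounds_nonneg(4)[OF \<epsilon> ux],
            of "b1 x" "b2 x" "c x"]
        show ?case
          unfolding grad_\<eta> W_def h_def
          by (simp only: power2_eq_square[of "\<phi> x"] mult.commute[of "\<phi> x * \<phi> x * ?G x"])
      qed
    qed
    finally show ?thesis .
  qed
  have "(\<lambda>k. LINT x|?M. (\<phi> x)\<^sup>2 * (u x * soft_recip (1 / Suc k) (u x))) \<longlonglongrightarrow> (LINT x|?M. (\<phi> x)\<^sup>2 * (1 / 2))"
  proof (rule integral_dominated_convergence[where w = "\<lambda>x. (\<phi> x)\<^sup>2 * (1 / 2)"])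
    have [measurable]: "soft_recip (1 / Suc k) \<in> borel_measurable borel" for k
      using continuous_soft_recip[of "1 / Suc k"] by (auto intro: borel_measurable_continuous_onI)
    show "(\<lambda>x. (\<phi> x)\<^sup>2 * (u x * soft_recip (1 / Suc k) (u x))) \<in> borel_measurable ?M" for k
      by measurable
    show "integrable ?M (\<lambda>x. (\<phi> x)\<^sup>2 * (1 / 2))" by (rule bd\<phi>) simp
    show "AE x in ?M. (\<lambda>k. (\<phi> x)\<^sup>2 * (u x * soft_recip (1 / Suc k) (u x))) \<longlonglongrightarrow> (\<phi> x)\<^sup>2 * (1 / 2)"
      using pos by eventually_elim (intro tendsto_mult_left soft_recip_limit)
    show "AE x in ?M. norm ((\<phi> x)\<^sup>2 * (u x * soft_recip (1 / Suc k) (u x))) \<le> (\<phi> x)\<^sup>2 * (1 / 2)" for k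
      using pos
    proof eventually_elim
      case (elim x)
      then show ?case
        using soft_recip_bounds_nonneg(3,4)[of "1 / Suc k" "u x"]
        unfolding real_norm_def abs_mult[of "(\<phi> x)\<^sup>2"] by (intro mult_mono) (auto simp del: of_nat_Suc)
    qed
  qed measurable
  then have "(\<lambda>k. \<mu> * (LINT x|?M. (\<phi> x)\<^sup>2 * (u x * soft_recip (1 / Suc k) (u x)))) \<longlonglongrightarrow> \<mu> * (LINT x|?M. (\<phi> x)\<^sup>2 * (1 / 2))"
    by (rule tendsto_mult_left)
  then have "\<mu> * (LINT x|?M. (\<phi> x)\<^sup>2 * (1 / 2)) \<le> (LINT x|?M. ?Q x)"
    by (rule LIMSEQ_le_const2) (use main in simp)
  then show ?thesis by simp
qed

section \<open>Hoelder continuous coefficients\<close>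

lemma holder_seminorm_bound:
  assumes "holder_on \<alpha> S f" and "x \<in> S" and "y \<in> S"
  shows "norm (f x - f y) \<le> holder_seminorm \<alpha> S f * dist x y powr \<alpha>"
proof (cases "x = y")
  case False
  obtain K where K: "\<And>x y. x \<in> S \<Longrightarrow> y \<in> S \<Longrightarrow> norm (f x - f y) \<le> K * dist x y powr \<alpha>"
    using assms(1) by (auto simp: holder_on_def)
  have "norm (f x - f y) / dist x y powr \<alpha> \<le> holder_seminorm \<alpha> S f"
    unfolding holder_seminorm_def
    by (rule cSUP_upper2[where x = "(x, y)"])
      (use False assms K in \<open>auto intro!: bdd_aboveI2[where M = K] simp: divide_le_eq\<close>)
  then show ?thesis using False by (simp add: divide_le_eq)
qed simp

lemma holder_on_continuous_bounded:
  fixes f :: "'a::euclidean_space \<Rightarrow> 'b::real_normed_vector"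
  assumes f: "holder_on \<alpha> (ball 0 R) f" and \<alpha>: "\<alpha> > 0" and R: "R > 0"
  shows "continuous_on (ball 0 R) f" and "\<exists>K. \<forall>x\<in>ball 0 R. norm (f x) \<le> K"
proof -
  let ?H = "holder_seminorm \<alpha> (ball 0 R) f"
  note b = holder_seminorm_bound[OF f]
  show "continuous_on (ball 0 R) f"
    unfolding continuous_on_def
  proof
    fix x :: 'a assume x: "x \<in> ball 0 R"
    have "((\<lambda>y. ?H * dist y x powr \<alpha>) \<longlongrightarrow> ?H * dist x x powr \<alpha>) (at x within ball 0 R)"
      using \<alpha> by (intro tendsto_intros tendsto_powr') auto
    then have "((\<lambda>y. ?H * dist y x powr \<alpha>) \<longlongrightarrow> 0) (at x within ball 0 R)" using \<alpha> by simp
    then have "((\<lambda>y. f y - f x) \<longlongrightarrow> 0) (at x within ball 0 R)"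
      by (rule Lim_null_comparison[rotated]) (auto simp: eventually_at_filter intro!: always_eventually b x)
    then show "(f \<longlongrightarrow> f x) (at x within ball 0 R)" by (simp add: LIM_zero_iff)
  qed
  have "norm (f x) \<le> norm (f 0) + \<bar>?H\<bar> * R powr \<alpha>" if x: "x \<in> ball 0 R" for x
  proof -
    have "norm (f x - f 0) \<le> ?H * dist x 0 powr \<alpha>" using x R by (intro b) auto
    also have "\<dots> \<le> \<bar>?H\<bar> * R powr \<alpha>" using x \<alpha> by (intro mult_mono powr_mono2) auto
    finally show ?thesis using norm_triangle_sub[of "f x" "f 0"] by simp
  qed
  then show "\<exists>K. \<forall>x\<in>ball 0 R. norm (f x) \<le> K" by blast
qed

lemma continuous_on_ball_measurable:
  fixes f :: "'a::euclidean_space \<Rightarrow> 'b::euclidean_space"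
  shows "continuous_on (ball 0 R) f \<Longrightarrow> f \<in> borel_measurable (lebesgue_on (ball 0 R))"
  by (rule continuous_imp_measurable_on_sets_lebesgue) auto

text \<open>The power \<open>1 / \<alpha>\<close> makes the seminorm scale like the inverse of a length; this lemma says which
  length.\<close>

lemma holder_oscillation_le_1:
  assumes f: "holder_on \<alpha> (ball 0 R) f" and \<alpha>: "\<alpha> > 0" and \<rho>: "0 < \<rho>" "\<rho> \<le> R"
    and le: "holder_seminorm \<alpha> (ball 0 R) f powr (1 / \<alpha>) \<le> 1 / \<rho>" and x: "norm x < \<rho>"
  shows "norm (f x - f 0) \<le> 1"
proof -
  let ?H = "holder_seminorm \<alpha> (ball 0 R) f"
  have bound: "norm (f x - f 0) \<le> ?H * norm x powr \<alpha>"
    using holder_seminorm_bound[OF f, of x 0] x \<rho> by simp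
  show ?thesis
  proof (cases "?H \<le> 0")
    case True
    then have "?H * norm x powr \<alpha> \<le> 0" by (simp add: mult_nonpos_nonneg)
    with bound show ?thesis by simp
  next
    case False
    then have "?H = (?H powr (1 / \<alpha>)) powr \<alpha>" using \<alpha> by (simp add: powr_powr)
    also have "\<dots> \<le> (1 / \<rho>) powr \<alpha>" using le \<alpha> by (intro powr_mono2) auto
    finally have "?H * norm x powr \<alpha> \<le> (1 / \<rho>) powr \<alpha> * \<rho> powr \<alpha>"
      using x \<alpha> by (intro mult_mono powr_mono2) auto
    also have "\<dots> = 1" using \<rho> by (simp add: powr_mult[symmetric])
    finally show ?thesis using bound by simp
  qed
qed

text \<open>After subtraction of the antisymmetric part of \<open>A0\<close>, the symmetric part of \<open>A0\<close> remains together
  with a perturbation of norm at most 1. For the symmetric part, Cauchy-Schwarz for a nonnegative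
  form needs only the bounds on the quadratic form. The weight \<open>\<delta>\<close> is chosen such that each of the two
  contributions uses up \<open>lam / 8\<close>.\<close>

lemma symmetrised_form_le:
  fixes A0 A1 :: "real^'n^'n" and \<xi> \<zeta> :: "real^'n"
  assumes lam: "0 < lam" "0 < Lam"
    and form: "\<And>\<xi>. 0 \<le> \<xi> \<bullet> (A0 *v \<xi>)" "\<And>\<xi>. \<xi> \<bullet> (A0 *v \<xi>) \<le> Lam * (\<xi> \<bullet> \<xi>)"
    and osc: "norm (A1 - A0) \<le> 1"
  shows "2 * (((A1 - (1 / 2) *\<^sub>R (A0 - transpose A0)) *v \<xi>) \<bullet> \<zeta>) \<le> lam / 4 * (\<xi> \<bullet> \<xi>) + 8 * (1 + Lam\<^sup>2) / lam * (\<zeta> \<bullet> \<zeta>)"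
proof -
  define \<delta> where "\<delta> = lam / (8 * Lam)"
  have \<delta>: "\<delta> > 0" using lam by (simp add: \<delta>_def)
  let ?s = "\<xi> \<bullet> (A0 *v \<zeta>) + \<zeta> \<bullet> (A0 *v \<xi>)"
  have "0 \<le> (\<delta> *\<^sub>R \<xi> - \<zeta>) \<bullet> (A0 *v (\<delta> *\<^sub>R \<xi> - \<zeta>))" by (rule form)
  also have "\<dots> = \<delta> * (\<delta> * (\<xi> \<bullet> (A0 *v \<xi>))) - \<delta> * ?s + \<zeta> \<bullet> (A0 *v \<zeta>)"
    by (simp add: matrix_vector_mult_diff_distrib matrix_vector_mult_scaleR inner_diff_left inner_diff_right algebra_simps)
  finally have "\<delta> * ?s \<le> \<delta> * (\<delta> * (\<xi> \<bullet> (A0 *v \<xi>))) + \<zeta> \<bullet> (A0 *v \<zeta>)" by simp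
  also have "\<dots> \<le> \<delta> * (\<delta> * (Lam * (\<xi> \<bullet> \<xi>))) + Lam * (\<zeta> \<bullet> \<zeta>)"
    using \<delta> by (intro add_mono mult_left_mono form) auto
  also have "\<dots> = \<delta> * (lam / 8 * (\<xi> \<bullet> \<xi>) + 8 * Lam\<^sup>2 / lam * (\<zeta> \<bullet> \<zeta>))"
    using lam by (simp add: \<delta>_def field_simps power2_eq_square)
  finally have s: "?s \<le> lam / 8 * (\<xi> \<bullet> \<xi>) + 8 * Lam\<^sup>2 / lam * (\<zeta> \<bullet> \<zeta>)"
    using \<delta> by (simp only: mult_le_cancel_left_pos)
  have "((A1 - A0) *v \<xi>) \<bullet> \<zeta> \<le> norm ((A1 - A0) *v \<xi>) * norm \<zeta>" by (rule norm_cauchy_schwarz)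
  also have "\<dots> \<le> (norm (A1 - A0) * norm \<xi>) * norm \<zeta>"
    by (intro mult_right_mono norm_matrix_vector_mult_le) auto
  also have "\<dots> \<le> norm \<xi> * norm \<zeta>"
    using osc by (intro mult_right_mono mult_left_le_one_le) auto
  finally have "2 * (((A1 - A0) *v \<xi>) \<bullet> \<zeta>) \<le> 2 * (norm \<xi> * norm \<zeta>)" by simp
  also have "\<dots> \<le> lam / 8 * (\<xi> \<bullet> \<xi>) + 8 / lam * (\<zeta> \<bullet> \<zeta>)"
  proof -
    have "0 \<le> (lam * norm \<xi> - 8 * norm \<zeta>)\<^sup>2" by simp
    then have "16 * lam * (norm \<xi> * norm \<zeta>) \<le> lam\<^sup>2 * (\<xi> \<bullet> \<xi>) + 64 * (\<zeta> \<bullet> \<zeta>)"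
      by (simp add: power2_diff power_mult_distrib power2_norm_eq_inner)
    then show ?thesis using lam by (simp add: field_simps power2_eq_square)
  qed
  finally have o: "2 * (((A1 - A0) *v \<xi>) \<bullet> \<zeta>) \<le> lam / 8 * (\<xi> \<bullet> \<xi>) + 8 / lam * (\<zeta> \<bullet> \<zeta>)" .
  have "2 * (((A1 - (1 / 2) *\<^sub>R (A0 - transpose A0)) *v \<xi>) \<bullet> \<zeta>) = 2 * (((A1 - A0) *v \<xi>) \<bullet> \<zeta>) + ?s"
  proof -
    have "A1 - (1 / 2) *\<^sub>R (A0 - transpose A0) = (A1 - A0) + (1 / 2) *\<^sub>R (A0 + transpose A0)"
      by (simp add: vec_eq_iff field_simps)
    moreover have "((1 / 2) *\<^sub>R (A0 + transpose A0)) *v \<xi> = (1 / 2) *\<^sub>R (A0 *v \<xi> + transpose A0 *v \<xi>)"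
      by (simp add: scaleR_matrix_vector_assoc[symmetric] matrix_vector_mult_add_rdistrib)
    ultimately have "(A1 - (1 / 2) *\<^sub>R (A0 - transpose A0)) *v \<xi> =
        (A1 - A0) *v \<xi> + (1 / 2) *\<^sub>R (A0 *v \<xi> + transpose A0 *v \<xi>)"
      by (simp only: matrix_vector_mult_add_rdistrib)
    then show ?thesis
      by (simp add: inner_left_distrib dot_lmul_matrix inner_commute[of "A0 *v \<xi>"])
  qed
  with s o show ?thesis by (simp add: add_divide_distrib distrib_left distrib_right)
qed

lemma sigma_bounds:
  assumes "ereal (real n) < q" and "0 \<le> x"
  shows "0 \<le> sigma n q x" and "sigma n q x \<le> y \<Longrightarrow> x \<le> y"
    and "sigma n q x \<le> y \<Longrightarrow> q \<noteq> \<infinity> \<Longrightarrow> x \<le> y powr (1 - real n / real_of_ereal q)"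
proof -
  show "0 \<le> sigma n q x" "sigma n q x \<le> y \<Longrightarrow> x \<le> y"
    using assms(2) by (auto simp: sigma_def le_max_iff_disj split: if_splits)
  assume le: "sigma n q x \<le> y" and q: "q \<noteq> \<infinity>"
  then obtain r where r: "q = ereal r" using assms(1) by (cases q) auto
  define e where "e = 1 - real n / r"
  have e: "e > 0" using assms(1) r by (simp add: e_def divide_less_eq)
  have "x powr (1 / e) \<le> y" using le r by (simp add: sigma_def e_def)
  then have "(x powr (1 / e)) powr e \<le> y powr e" using e by (intro powr_mono2) auto
  moreover have "(x powr (1 / e)) powr e = x" using e assms(2) by (simp add: powr_powr)
  ultimately show "x \<le> y powr (1 - real n / real_of_ereal q)"
    using r by (simp add: e_def)
qed

section \<open>The eigenvalue bound\<close>

text \<open>The scaled form of the theorem: \<open>\<rho>\<close> is a length at which all coefficients are controlled, and the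
  cut-off function is the bump of radius \<open>\<rho>\<close>. Every term of the energy estimate is at most a constant
  times \<open>\<rho>\<^sup>n / \<rho>\<^sup>2\<close>, whereas the integral of the squared bump is at least a constant times \<open>\<rho>\<^sup>n\<close>.\<close>

lemma eigenvalue_le_of_small_coefficients:
  fixes A :: "real^'n \<Rightarrow> real^'n^'n" and b1 b2 :: "real^'n \<Rightarrow> real^'n" and c :: "real^'n \<Rightarrow> real"
  defines "V \<equiv> unit_ball_vol CARD('n)"
  defines "V2 \<equiv> V + 2 ^ CARD('n)"
  assumes n: "CARD('n) \<ge> 2" and lam: "0 < lam" "0 < Lam" and \<alpha>: "0 < \<alpha>" and q: "ereal (real CARD('n)) < q"
    and ell: "\<And>x \<xi>. x \<in> ball 0 R \<Longrightarrow> lam * (\<xi> \<bullet> \<xi>) \<le> \<xi> \<bullet> (A x *v \<xi>)"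
      "\<And>x \<xi>. x \<in> ball 0 R \<Longrightarrow> \<xi> \<bullet> (A x *v \<xi>) \<le> Lam * (\<xi> \<bullet> \<xi>)"
    and A: "holder_on \<alpha> (ball 0 R) A" and b1: "holder_on \<alpha> (ball 0 R) b1"
    and b2: "in_Lq q (ball 0 R) b2" and c: "in_Lq q (ball 0 R) c"
    and \<mu>: "principal_eigenvalue (ball 0 R) A b1 b2 c \<mu>"
    and \<rho>: "0 < \<rho>" "2 * \<rho> \<le> R"
    and smallA: "holder_seminorm \<alpha> (ball 0 R) A powr (1 / \<alpha>) \<le> 1 / \<rho>"
    and smallb1: "AE x in lebesgue_on (ball 0 R). norm (b1 x) \<le> 1 / \<rho>"
    and smallb2: "Lq_ul_norm q R b2 \<le> \<rho> powr - 1"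
      "q \<noteq> \<infinity> \<Longrightarrow> Lq_ul_norm q R b2 \<le> \<rho> powr (real CARD('n) / real_of_ereal q - 1)"
    and smallc: "Lq_ul_norm q R c \<le> \<rho> powr - 2"
      "q \<noteq> \<infinity> \<Longrightarrow> Lq_ul_norm q R c \<le> \<rho> powr (real CARD('n) / real_of_ereal q - 2)"
  shows "\<mu> \<le> 2 * exp 4 * 2 ^ CARD('n) / V *
    (((8 * (1 + Lam\<^sup>2) / lam + 1 / 2) * 16 + (1 / 2 + 1 / lam)) * V + (1 / lam) * V2 + 1 / 2 * V2) / \<rho>\<^sup>2"
proof (cases "\<mu> \<le> 0")
  case True
  have "0 < V" by (simp add: V_def)
  then have "0 \<le> 2 * exp 4 * 2 ^ CARD('n) / V *
    (((8 * (1 + Lam\<^sup>2) / lam + 1 / 2) * 16 + (1 / 2 + 1 / lam)) * V + (1 / lam) * V2 + 1 / 2 * V2) / \<rho>\<^sup>2"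
    using lam by (simp add: V2_def)
  with True show ?thesis by linarith
next
  case False
  let ?\<Omega> = "ball (0::real^'n) R" and ?K = "8 * (1 + Lam\<^sup>2) / lam"
  let ?M = "lebesgue_on ?\<Omega>"
  let ?\<phi> = "bump \<rho> :: real^'n \<Rightarrow> real" and ?J = "indicator (ball 0 \<rho>) :: real^'n \<Rightarrow> real"
  have \<Omega>: "?\<Omega> \<in> lmeasurable" by simp
  have R: "R > 0" and V: "V > 0" using \<rho> by (auto simp: V_def)
  have zero: "0 \<in> ?\<Omega>" using R by simp
  obtain u where pos: "AE x in ?M. u x > 0"
    and ef: "eigenfunction ?\<Omega> A b1 b2 c (complex_of_real \<mu>) (\<lambda>x. complex_of_real (u x))"
    using \<mu> unfolding principal_eigenvalue_def by blast
  then obtain Du where H: "H10 ?\<Omega> u Du" and weak: "\<And>\<psi>. test_function ?\<Omega> \<psi> \<Longrightarrow>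
      neg_L_form ?\<Omega> A b1 b2 c u Du \<psi> = (LINT x|?M. \<mu> * u x * \<psi> x)"
    unfolding eigenfunction_def weak_solution_def by auto
  have Du: "in_Lq 2 ?\<Omega> Du" and wg: "weak_gradient ?\<Omega> u Du" using H by (auto simp: H10_def)
  \<comment> \<open>The antisymmetric part of \<open>A 0\<close>, which may be subtracted from \<open>A\<close> without changing the equation.\<close>
  define S where "S = (1 / 2) *\<^sub>R (A 0 - transpose (A 0))"
  have S: "S $ i $ j = - S $ j $ i" for i j by (simp add: S_def transpose_def field_simps)
  obtain KA where KA: "\<And>x. x \<in> ?\<Omega> \<Longrightarrow> norm (A x) \<le> KA"
    using holder_on_continuous_bounded(2)[OF A \<alpha> R] by blast
  obtain Kb where Kb: "\<And>x. x \<in> ?\<Omega> \<Longrightarrow> norm (b1 x) \<le> Kb"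
    using holder_on_continuous_bounded(2)[OF b1 \<alpha> R] by blast
  note mA = continuous_on_ball_measurable[OF holder_on_continuous_bounded(1)[OF A \<alpha> R]]
  note mb1 = continuous_on_ball_measurable[OF holder_on_continuous_bounded(1)[OF b1 \<alpha> R]]
  have SS: "\<xi> \<bullet> (S *v \<xi>) = 0" for \<xi>
    by (simp add: S_def scaleR_matrix_vector_assoc[symmetric] matrix_vector_mult_diff_rdistrib
        inner_diff_right inner_commute[of \<xi> "\<xi> v* A 0"] dot_lmul_matrix)
  have "ereal 2 \<le> ereal (real CARD('n))" using n by simp
  with q have q2: "ereal 2 \<le> q" by (metis less_imp_le order_trans)
  then have q1: "ereal 1 \<le> q" by (rule order_trans[rotated]) simp
  have L2: "in_Lq 2 ?\<Omega> b2" "in_Lq 2 ?\<Omega> c"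
    using integrable_powr_of_in_Lq[OF \<Omega> b2 _ q2] integrable_powr_of_in_Lq[OF \<Omega> c _ q2] b2 c
    by (auto simp: in_Lq_2_iff in_Lq_def)
  have \<phi>: "test_function ?\<Omega> ?\<phi>"
    by (rule test_function_bump) (use \<rho> in auto)
  let ?Q = "\<lambda>x. (?K + 1 / 2) * (norm (gradient ?\<phi> x))\<^sup>2 + (1 / 2 + 1 / lam) * ((?\<phi> x)\<^sup>2 * (norm (b1 x))\<^sup>2)
      + 1 / lam * ((?\<phi> x)\<^sup>2 * (norm (b2 x))\<^sup>2) + 1 / 2 * ((?\<phi> x)\<^sup>2 * \<bar>c x\<bar>)"
  have energy: "\<mu> * (LINT x|?M. (?\<phi> x)\<^sup>2) \<le> 2 * (LINT x|?M. ?Q x)"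
  proof (rule eigenvalue_energy_bound[OF \<Omega> H pos, where B = "\<lambda>x. A x - S"])
    show "(\<lambda>x. A x - S) \<in> borel_measurable ?M" using mA by measurable
    show "norm (A x - S) \<le> KA + norm S" if "x \<in> ?\<Omega>" for x
      using KA[OF that] norm_triangle_ineq4[of "A x" S] by simp
    show "lam * (\<xi> \<bullet> \<xi>) \<le> \<xi> \<bullet> ((A x - S) *v \<xi>)" if "x \<in> ?\<Omega>" for x \<xi>
      using ell(1)[OF that] SS by (simp add: matrix_vector_mult_diff_rdistrib inner_diff_right)
    show "2 * (((A x - S) *v \<xi>) \<bullet> \<zeta>) \<le> lam / 4 * (\<xi> \<bullet> \<xi>) + ?K * (\<zeta> \<bullet> \<zeta>)" if "x \<in> ?\<Omega>" "?\<phi> x \<noteq> 0" for x \<xi> \<zeta>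
      unfolding S_def
    proof (rule symmetrised_form_le[OF lam])
      show "0 \<le> \<xi> \<bullet> (A 0 *v \<xi>)" for \<xi>
        using ell(1)[OF zero, of \<xi>] lam by (meson inner_ge_zero less_imp_le mult_nonneg_nonneg order_trans)
      show "\<xi> \<bullet> (A 0 *v \<xi>) \<le> Lam * (\<xi> \<bullet> \<xi>)" for \<xi> by (rule ell(2)[OF zero])
      show "norm (A x - A 0) \<le> 1"
        by (rule holder_oscillation_le_1[OF A \<alpha> \<rho>(1) _ smallA])
          (use that \<rho> bump_eq_0_iff[OF \<rho>(1)] in \<open>auto simp: not_le[symmetric]\<close>)
    qed
    show "neg_L_form ?\<Omega> (\<lambda>x. A x - S) b1 b2 c u Du \<psi> = (LINT x|?M. \<mu> * u x * \<psi> x)"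
      if "test_function ?\<Omega> \<psi>" for \<psi>
      using neg_L_form_diff_antisymmetric[OF \<Omega> Du wg S that] weak[OF that] by simp
  qed (use lam L2 \<phi> mb1 Kb in auto)
  have int1: "integrable ?M (\<lambda>x. ?J x * f x)" if "integrable ?M f" for f
    by (rule integrable_bounded_mult[OF that, where K = 1])
      (auto intro!: borel_measurable_lebesgue_onI simp: indicator_def)
  interpret finite_measure ?M by (rule finite_measure_lebesgue_on) simp
  have i1: "integrable ?M ?J" using int1[of "\<lambda>_. 1"] by simp
  have ib: "integrable ?M (\<lambda>x. norm (b2 x) powr 2)" "integrable ?M (\<lambda>x. norm (c x) powr 1)"
    using integrable_powr_of_in_Lq[OF \<Omega> b2 _ q2] integrable_powr_of_in_Lq[OF \<Omega> c _ q1] by auto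
  have vol: "(LINT x|?M. indicator (ball 0 r) x) = V * r ^ CARD('n)" if "0 < r" "r \<le> R" for r
  proof -
    have "ball 0 r \<subseteq> ?\<Omega>" using that by (intro subset_ball)
    then have "(LINT x|?M. indicator (ball 0 r) x) = measure ?M (ball 0 r)"
      by (simp add: Int_absorb2)
    also have "\<dots> = measure lborel (ball (0::real^'n) r)"
      using \<open>ball 0 r \<subseteq> ?\<Omega>\<close> by (subst measure_restrict_space) (auto simp: measure_completion)
    finally show ?thesis using that by (simp add: content_ball V_def)
  qed
  have \<phi>1: "(?\<phi> x)\<^sup>2 \<le> ?J x" for x
    using bump_eq_0_iff[OF \<rho>(1), of x] bump_nonneg[of \<rho> x] bump_le_1[of \<rho> x]
    by (auto simp: indicator_def power_le_one not_less)
  let ?P = "\<lambda>x. ((?K + 1 / 2) * 16 + (1 / 2 + 1 / lam)) / \<rho>\<^sup>2 * ?J x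
      + 1 / lam * (?J x * norm (b2 x) powr 2) + 1 / 2 * (?J x * norm (c x) powr 1)"
  have "AE x in ?M. ?Q x \<le> ?P x"
    using smallb1
  proof eventually_elim
    case (elim x)
    have g: "(norm (gradient ?\<phi> x))\<^sup>2 \<le> 16 / \<rho>\<^sup>2 * ?J x"
    proof (cases "x \<in> ball 0 \<rho>")
      case True
      then show ?thesis
        using power_mono[OF norm_gradient_bump_le(1)[OF \<rho>(1), of x], of 2] by (simp add: power_divide)
    next
      case False
      then show ?thesis
        using norm_gradient_bump_le(2)[OF \<rho>(1), of x] by simp
    qed
    have "(?\<phi> x)\<^sup>2 * (norm (b1 x))\<^sup>2 \<le> ?J x * (1 / \<rho>)\<^sup>2"
      using elim by (intro mult_mono \<phi>1 power_mono) auto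
    then have b: "(?\<phi> x)\<^sup>2 * (norm (b1 x))\<^sup>2 \<le> 1 / \<rho>\<^sup>2 * ?J x" by (simp add: power_divide)
    have "?Q x \<le> (?K + 1 / 2) * (16 / \<rho>\<^sup>2 * ?J x) + (1 / 2 + 1 / lam) * (1 / \<rho>\<^sup>2 * ?J x)
        + 1 / lam * (?J x * (norm (b2 x))\<^sup>2) + 1 / 2 * (?J x * \<bar>c x\<bar>)"
      using lam by (intro add_mono mult_left_mono g b mult_right_mono \<phi>1) auto
    also have "\<dots> = ?P x" by (simp add: algebra_simps add_divide_distrib)
    finally show ?case .
  qed
  moreover have iP: "integrable ?M ?P"
    by (intro Bochner_Integration.integrable_add integrable_mult_right int1 ib i1)
  ultimately have "(LINT x|?M. ?Q x) \<le> (LINT x|?M. ?P x)"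
    using lam by (intro integral_mono_AE') (auto intro!: AE_I2 add_nonneg_nonneg)
  also have "\<dots> = ((?K + 1 / 2) * 16 + (1 / 2 + 1 / lam)) / \<rho>\<^sup>2 * (LINT x|?M. ?J x)
      + 1 / lam * (LINT x|?M. ?J x * norm (b2 x) powr 2) + 1 / 2 * (LINT x|?M. ?J x * norm (c x) powr 1)"
    using int1[OF ib(1)] int1[OF ib(2)] i1 by simp
  also have "\<dots> \<le> ((?K + 1 / 2) * 16 + (1 / 2 + 1 / lam)) / \<rho>\<^sup>2 * (V * \<rho> ^ CARD('n))
      + 1 / lam * (V2 * \<rho> ^ CARD('n) / \<rho>\<^sup>2) + 1 / 2 * (V2 * \<rho> ^ CARD('n) / \<rho>\<^sup>2)"
  proof (intro add_mono mult_left_mono)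
    show "(LINT x|?M. ?J x) \<le> V * \<rho> ^ CARD('n)" using vol[of \<rho>] \<rho> by simp
    show "(LINT x|?M. ?J x * norm (b2 x) powr 2) \<le> V2 * \<rho> ^ CARD('n) / \<rho>\<^sup>2"
      using integral_ball_powr_le[OF b2 \<rho> _ q2, of 1] smallb2 by (simp add: V2_def V_def)
    show "(LINT x|?M. ?J x * norm (c x) powr 1) \<le> V2 * \<rho> ^ CARD('n) / \<rho>\<^sup>2"
      using integral_ball_powr_le[OF c \<rho> _ q1, of 2] smallc by (simp add: V2_def V_def)
  qed (use lam in auto)
  finally have upper: "(LINT x|?M. ?Q x) \<le> (((?K + 1 / 2) * 16 + (1 / 2 + 1 / lam)) * V + 1 / lam * V2 + 1 / 2 * V2) / \<rho>\<^sup>2 * \<rho> ^ CARD('n)"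
    (is "_ \<le> ?C / \<rho>\<^sup>2 * _")
    by (simp add: algebra_simps add_divide_distrib)
  have "(LINT x|?M. exp (- 4) * indicator (ball 0 (\<rho> / 2)) x) \<le> (LINT x|?M. (?\<phi> x)\<^sup>2)"
  proof (rule integral_mono)
    show "integrable ?M (\<lambda>x. (?\<phi> x)\<^sup>2)"
      using in_Lq_2_test_function(1)[OF \<Omega> \<phi>] by (simp add: in_Lq_2_iff)
    show "integrable ?M (\<lambda>x. exp (- 4) * indicator (ball 0 (\<rho> / 2)) x :: real)"
      by (intro integrable_mult_right integrable_const_bound[where B = 1])
        (auto intro!: borel_measurable_lebesgue_onI simp: indicator_def)
    show "exp (- 4) * indicator (ball 0 (\<rho> / 2)) x \<le> (?\<phi> x)\<^sup>2" for x
    proof (cases "x \<in> ball 0 (\<rho> / 2)")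
      case True
      then have "(exp (- 2))\<^sup>2 \<le> (?\<phi> x)\<^sup>2"
        by (intro power_mono bump_ge \<rho>(1)) auto
      then show ?thesis using True by (simp add: exp_double[symmetric])
    qed simp
  qed
  then have lower: "exp (- 4) * (V * (\<rho> / 2) ^ CARD('n)) \<le> (LINT x|?M. (?\<phi> x)\<^sup>2)"
    using vol[of "\<rho> / 2"] \<rho> by simp
  have "\<mu> * (exp (- 4) * (V * (\<rho> / 2) ^ CARD('n))) \<le> \<mu> * (LINT x|?M. (?\<phi> x)\<^sup>2)"
    using False by (intro mult_left_mono lower) auto
  also have "\<dots> \<le> 2 * (?C / \<rho>\<^sup>2 * \<rho> ^ CARD('n))" using energy upper by linarith
  also have "\<mu> * (exp (- 4) * (V * (\<rho> / 2) ^ CARD('n))) = \<mu> * (exp (- 4) * V / 2 ^ CARD('n)) * \<rho> ^ CARD('n)"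
    by (simp add: power_divide)
  finally have "\<mu> * (exp (- 4) * V / 2 ^ CARD('n)) * \<rho> ^ CARD('n) \<le> (2 * (?C / \<rho>\<^sup>2)) * \<rho> ^ CARD('n)"
    by (simp only: mult.assoc)
  then have "\<mu> * (exp (- 4) * V / 2 ^ CARD('n)) \<le> 2 * (?C / \<rho>\<^sup>2)"
    using \<rho> by (simp only: mult_le_cancel_right_pos zero_less_power)
  then have "\<mu> \<le> 2 * (?C / \<rho>\<^sup>2) / (exp (- 4) * V / 2 ^ CARD('n))"
    using V by (subst pos_le_divide_eq) auto
  also have "\<dots> = 2 * exp 4 * 2 ^ CARD('n) / V * ?C / \<rho>\<^sup>2"
    by (simp add: exp_minus field_simps)
  finally show ?thesis .
qed

theorem theorem2p8:
  fixes lam Lam \<alpha> :: real and q :: ereal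
  assumes "CARD('n::finite) \<ge> 2"
    and "0 < lam" and "lam \<le> Lam"
    and "ereal (real CARD('n)) < q"
    and "0 < \<alpha>" and "ereal \<alpha> < 1 - ereal (real CARD('n)) / q"
  shows "\<exists>C0>0. \<forall>R>0. \<forall>(A :: real^'n \<Rightarrow> real^'n^'n) (b1 :: real^'n \<Rightarrow> real^'n)
       (b2 :: real^'n \<Rightarrow> real^'n) (c :: real^'n \<Rightarrow> real) (lambda1 :: real).
     (\<forall>x\<in>ball 0 R. \<forall>\<xi>. lam * (\<xi> \<bullet> \<xi>) \<le> \<xi> \<bullet> (A x *v \<xi>) \<and> \<xi> \<bullet> (A x *v \<xi>) \<le> Lam * (\<xi> \<bullet> \<xi>)) \<longrightarrow>
     holder_on \<alpha> (ball 0 R) A \<longrightarrow> holder_on \<alpha> (ball 0 R) b1 \<longrightarrow>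
     in_Lq q (ball 0 R) b2 \<longrightarrow> in_Lq q (ball 0 R) c \<longrightarrow>
     principal_eigenvalue (ball 0 R) A b1 b2 c lambda1 \<longrightarrow>
     lambda1 \<le> C0 * (M1 q \<alpha> R A b1 b2 c + 1 / R)\<^sup>2"
proof -
  define V where "V = unit_ball_vol CARD('n)"
  define V2 where "V2 = V + 2 ^ CARD('n)"
  define C where "C = 2 * exp 4 * 2 ^ CARD('n) / V *
    (((8 * (1 + Lam\<^sup>2) / lam + 1 / 2) * 16 + (1 / 2 + 1 / lam)) * V + (1 / lam) * V2 + 1 / 2 * V2)"
  have V: "V > 0" by (simp add: V_def)
  then have V2: "V2 > 0" by (simp add: V2_def add_pos_pos)
  have "C > 0"
    unfolding C_def using assms(2) V V2
    by (intro mult_pos_pos divide_pos_pos add_pos_pos add_nonneg_pos) auto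
  show ?thesis
  proof (intro exI[of _ "4 * C"] conjI allI impI)
    show "4 * C > 0" using \<open>C > 0\<close> by simp
    fix R :: real and A :: "real^'n \<Rightarrow> real^'n^'n" and b1 b2 :: "real^'n \<Rightarrow> real^'n"
      and c :: "real^'n \<Rightarrow> real" and lambda1 :: real
    assume R: "R > 0"
      and ell: "\<forall>x\<in>ball 0 R. \<forall>\<xi>. lam * (\<xi> \<bullet> \<xi>) \<le> \<xi> \<bullet> (A x *v \<xi>) \<and> \<xi> \<bullet> (A x *v \<xi>) \<le> Lam * (\<xi> \<bullet> \<xi>)"
      and A: "holder_on \<alpha> (ball 0 R) A" and b1: "holder_on \<alpha> (ball 0 R) b1"
      and b2: "in_Lq q (ball 0 R) b2" and c: "in_Lq q (ball 0 R) c"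
      and ev: "principal_eigenvalue (ball 0 R) A b1 b2 c lambda1"
    let ?M = "lebesgue_on (ball (0::real^'n) R)" and ?n = "CARD('n)"
    have nonnull: "emeasure ?M (space ?M) \<noteq> 0"
      using R unit_ball_vol_pos[of "real DIM(real^'n)"]
      by (simp add: emeasure_restrict_space emeasure_ball ennreal_zero_less_mult_iff less_imp_neq[symmetric])
    obtain K where "\<And>x. x \<in> ball 0 R \<Longrightarrow> norm (b1 x) \<le> K"
      using holder_on_continuous_bounded(2)[OF b1 assms(5) R] by blast
    then have "AE x in ?M. norm (b1 x) \<le> K" by (intro AE_I2) simp
    then have Lb1: "in_Lq \<infinity> (ball 0 R) b1"
      using continuous_on_ball_measurable[OF holder_on_continuous_bounded(1)[OF b1 assms(5) R]]
      by (auto simp: in_Lq_def)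
    have ul_nonneg: "0 \<le> Lq_ul_norm q R h" if "in_Lq q (ball 0 R) h" for h :: "real^'n \<Rightarrow> 'b::euclidean_space"
    proof (cases "q = \<infinity>")
      case True
      then show ?thesis using Lq_norm_infinity_AE(2)[OF _ nonnull, of h] that by (simp add: Lq_ul_norm_def)
    next
      case False
      then obtain r where r: "q = ereal r" "real ?n < r" using assms(4) by (cases q) auto
      then have "r > 0" by (metis of_nat_0_le_iff order_le_less_trans)
      then show ?thesis
        using integral_unit_ball_le_Lq_ul_norm(2)[of r R h 0] that r R by simp
    qed
    define s1 s2 s3 s4 s5 where
      "s1 = holder_seminorm \<alpha> (ball 0 R) A powr (1 / \<alpha>)" and
      "s2 = holder_seminorm \<alpha> (ball 0 R) b1 powr (1 / (\<alpha> + 1))" and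
      "s3 = Lq_norm \<infinity> (ball 0 R) b1" and
      "s4 = sigma ?n q (Lq_ul_norm q R b2)" and
      "s5 = sigma ?n (2 * q) (sqrt (Lq_ul_norm q R c))"
    have n2q: "ereal (real ?n) < 2 * q"
      using assms(4) by (cases q) auto
    have sqrt0: "0 \<le> sqrt (Lq_ul_norm q R c)" using ul_nonneg[OF c] by simp
    note sb2 = sigma_bounds[OF assms(4) ul_nonneg[OF b2]] and sc = sigma_bounds[OF n2q sqrt0]
    have nonneg: "0 \<le> s1" "0 \<le> s2" "0 \<le> s3" "0 \<le> s4" "0 \<le> s5"
      using Lq_norm_infinity_AE(2)[OF Lb1 nonnull] sb2(1) sc(1)
      by (auto simp: s1_def s2_def s3_def s4_def s5_def)
    define X where "X = M1 q \<alpha> R A b1 b2 c + 1 / R"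
    \<comment> \<open>The factor 2 yields \<open>2 * \<rho> \<le> R\<close>, the room that the integration over translated unit balls needs.\<close>
    define \<rho> where "\<rho> = 1 / (2 * X)"
    have X: "X = s1 + s2 + s3 + s4 + s5 + 1 / R"
      by (simp add: X_def M1_def s1_def s2_def s3_def s4_def s5_def)
    have X0: "X > 0" using nonneg R by (simp add: X add_nonneg_pos)
    have \<rho>: "\<rho> > 0" "1 / \<rho> = 2 * X" using X0 by (auto simp: \<rho>_def)
    have "1 / R \<le> X" using nonneg by (simp add: X)
    then have \<rho>R: "2 * \<rho> \<le> R" using X0 R by (simp add: \<rho>_def field_simps)
    have s: "s1 \<le> 1 / \<rho>" "s3 \<le> 1 / \<rho>" "s4 \<le> 1 / \<rho>" "s5 \<le> 1 / \<rho>"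
      unfolding \<rho>(2) X using nonneg R by (auto intro: add_nonneg_nonneg)
    \<comment> \<open>The exponent \<open>1 / (1 - n / q)\<close> in the definition of \<open>sigma\<close> turns the bound by \<open>1 / \<rho>\<close> into the
      power of \<open>\<rho>\<close> that the local estimate requires.\<close>
    have inv: "(1 / \<rho>) powr t = \<rho> powr (- t)" for t
      using \<rho>(1) by (simp add: powr_divide powr_minus_divide)
    have "lambda1 \<le> C / \<rho>\<^sup>2"
      unfolding C_def V2_def V_def
    proof (rule eigenvalue_le_of_small_coefficients[OF assms(1,2) _ assms(5,4) _ _ A b1 b2 c ev \<rho>(1) \<rho>R])
      show "0 < Lam" using assms(2,3) by simp
      show "holder_seminorm \<alpha> (ball 0 R) A powr (1 / \<alpha>) \<le> 1 / \<rho>" using s(1) by (simp add: s1_def)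
      show "AE x in ?M. norm (b1 x) \<le> 1 / \<rho>"
        using Lq_norm_infinity_AE(1)[OF Lb1 nonnull] by eventually_elim (use s(2) in \<open>simp add: s3_def\<close>)
      show "Lq_ul_norm q R b2 \<le> \<rho> powr - 1"
        using sb2(2)[of "1 / \<rho>"] s(3) inv[of 1] \<rho>(1) by (simp add: s4_def)
      show "Lq_ul_norm q R b2 \<le> \<rho> powr (real ?n / real_of_ereal q - 1)" if "q \<noteq> \<infinity>"
        using sb2(3)[of "1 / \<rho>"] s(3) that inv[of "1 - real ?n / real_of_ereal q"] by (simp add: s4_def)
      have sq: "Lq_ul_norm q R c = (sqrt (Lq_ul_norm q R c))\<^sup>2" using ul_nonneg[OF c] by simp
      have "sqrt (Lq_ul_norm q R c) \<le> \<rho> powr - 1"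
        using sc(2)[of "1 / \<rho>"] s(4) inv[of 1] \<rho>(1) by (simp add: s5_def)
      from power_mono[OF this sqrt0, of 2] show "Lq_ul_norm q R c \<le> \<rho> powr - 2"
        unfolding sq[symmetric] power2_eq_square powr_add[symmetric] by simp
      show "Lq_ul_norm q R c \<le> \<rho> powr (real ?n / real_of_ereal q - 2)" if fin: "q \<noteq> \<infinity>"
      proof -
        obtain r where r: "q = ereal r" using fin assms(4) by (cases q) auto
        have "sqrt (Lq_ul_norm q R c) \<le> \<rho> powr (real ?n / (2 * r) - 1)"
          using sc(3)[of "1 / \<rho>"] s(4) r inv[of "1 - real ?n / (2 * r)"] by (simp add: s5_def)
        from power_mono[OF this sqrt0, of 2] show ?thesis
          unfolding sq[symmetric] power2_eq_square powr_add[symmetric] using r by simp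
      qed
    qed (use ell in auto)
    also have "\<dots> = 4 * C * X\<^sup>2"
      using X0 by (simp add: \<rho>_def power_divide power_mult_distrib)
    finally show "lambda1 \<le> 4 * C * (M1 q \<alpha> R A b1 b2 c + 1 / R)\<^sup>2" by (simp add: X_def)
  qed
qed

end
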